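(* Let $f:\mathbb{R}_{++}\to\mathbb{R}$ be a differentiable function such that $s\mapsto s f'(s)$ is monotonically increasing on $\mathbb{R}_{++}$. Then, for any full-rank matrices $X,Y\in\mathbb{R}^{m\times n}$, $$\sum_{i=1}^{\min\{m,n\}} f\big(\sigma_i(X)\,\sigma_{\min\{m,n\}-i+1}(Y)\big)\le \sum_{i=1}^{\min\{m,n\}} f\big(\sigma_i(X^\top Y)\big)\le \sum_{i=1}^{\min\{m,n\}} f\big(\sigma_i(X)\,\sigma_i(Y)\big).$$ If $f$ is additionally defined and right-continuous at $0$, then the inequalities hold for any matrices $X,Y\in\mathbb{R}^{m\times n}$.
   Context: $m,n$ are arbitrary positive integers. $\mathbb{R}_{++}$ denotes the set of positive real numbers. For a real $p\times q$ matrix $Z$, $\sigma_1(Z)\ge\cdots\ge\sigma_{\min\{p,q\}}(Z)\ge 0$ denote its singular values in descending order (with multiplicity). A matrix in $\mathbb{R}^{m\times n}$ is full-rank if its rank is $\min\{m,n\}$. "Monotonically increasing" means nondecreasing (not necessarily strictly increasing).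
   Formalization: The formal theorem assumes m ≤ n instead of arbitrary positive m, n; for m > n the claim is false, e.g. m=2, n=1, X=(1,0)ᵀ, Y=(1,1)ᵀ, f(s)=s would require √2 ≤ 1. *)

theory Defs
  imports
    "HOL-Computational_Algebra.Computational_Algebra"
    "Jordan_Normal_Form.DL_Rank"
    "Jordan_Normal_Form.Char_Poly"
begin

definition full_rank :: "real mat \<Rightarrow> bool" where
  "full_rank A \<longleftrightarrow> vec_space.rank (dim_row A) A = min (dim_row A) (dim_col A)"

(* The square roots of the eigenvalues of the Gram matrix, repeated according to algebraic
   multiplicity and listed in descending order.  The Gram matrix of a p x q matrix is symmetric
   positive semidefinite, so this list has length q; if p < q, its last q - p entries are zeros
   that do not count as singular values, and only the indices 1, ..., min p q are meaningful. *)
definition gram_roots :: "real mat \<Rightarrow> real list" where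
  "gram_roots A =
     rev (sorted_list_of_multiset (image_mset sqrt (proots (char_poly (transpose_mat A * A)))))"

(* 1-based: the singular values of a p x q matrix are singular_value A i for 1 <= i <= min p q. *)
definition singular_value :: "real mat \<Rightarrow> nat \<Rightarrow> real" where
  "singular_value A i = gram_roots A ! (i - 1)"

end

theory Submission
  imports Defs
begin

text \<open>
  Put $A = XX^T$ and $B = YY^T$. Since $PQ$ and $QP$ have the same nonzero eigenvalues, the squared
  singular values of $X$, $Y$ and $X^TY$ are, up to zeros, the eigenvalues of the $m \times m$
  matrices $A$, $B$ and $AB$; the last ones are also those of the symmetric matrix $R^TAR$ when
  $B = RR^T$. The function $f \circ \exp$ is convex, so by Karamata's inequality it suffices, for
  positive definite $A$ and $B$, to compare products of eigenvalues over index sets. Both comparisons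
  are instances of a multiplicative Lidskii inequality
  $\prod_{i \in I} \lambda_i(R^TAR) \le \prod_{i \in I} \lambda_i(R^TR) \prod_{j \le |I|} \lambda_j(A)$:
  the upper bound directly, the lower bound by applying it to $R^TAR$ and $R^{-1}$. The singular case
  follows by letting $t \to 0$ in $A + tI$ and $B + tI$, where Weyl's monotonicity principle
  controls the eigenvalues of the product.
\<close>

section \<open>Characteristic polynomials of products\<close>

text \<open>The convexity of f o exp is the hypothesis in disguise: its derivative at s is e^s
  f'(e^s). Since f need not be monotone, one-sided (weak) majorization would not suffice; the total
  products have to agree as well, and they do because both bounds multiply out to det A det B. The
  factors \<lambda>_i(A) \<lambda>_{m+1-i}(B) of the lower bound are in general not sorted, so the
  product inequalities are needed for arbitrary index sets rather than for leading ones only. As A B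
  is not symmetric, what is known of its eigenvalues, even that they are real, is read off from R^T
  A R. Full rank enters through m \<le> n: then A and B are positive definite, and f is evaluated at
  positive arguments only.\<close>

lemma char_poly_four_block_upper_right_zero:
  fixes A :: "'a :: idom mat"
  assumes A: "A \<in> carrier_mat n n" and C: "C \<in> carrier_mat m n" and D: "D \<in> carrier_mat m m"
  shows "char_poly (four_block_mat A (0\<^sub>m n m) C D) = char_poly A * char_poly D"
proof -
  have eq: "char_poly_matrix (four_block_mat A (0\<^sub>m n m) C D)
      = four_block_mat (char_poly_matrix A) (0\<^sub>m n m) (map_mat (\<lambda>a. [:- a:]) C) (char_poly_matrix D)"
    by (rule eq_matI) (use assms in \<open>auto simp: char_poly_matrix_def one_poly_def\<close>)
  show ?thesis
    unfolding char_poly_def eq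
    by (rule det_four_block_mat_upper_right_zero) (use assms in auto)
qed

lemma char_poly_zero_mat: "char_poly (0\<^sub>m n n :: 'a :: comm_ring_1 mat) = monom 1 n"
proof -
  have "char_poly (0\<^sub>m n n :: 'a mat) = (\<Prod>a\<leftarrow>diag_mat (0\<^sub>m n n :: 'a mat). [:- a, 1:])"
    by (rule char_poly_upper_triangular[of _ n]) auto
  also have "diag_mat (0\<^sub>m n n :: 'a mat) = replicate n 0"
    by (rule nth_equalityI) (auto simp: diag_mat_def)
  finally show ?thesis
    by (simp add: monom_altdef)
qed

(* The block matrices [PQ, 0; Q, 0] and [0, 0; Q, QP] are conjugate by [1, P; 0, 1]. *)
lemma char_poly_mult_comm:
  fixes P :: "'a :: idom mat"
  assumes P: "P \<in> carrier_mat n m" and Q: "Q \<in> carrier_mat m n"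
  shows "monom 1 m * char_poly (P * Q) = monom 1 n * char_poly (Q * P)"
proof -
  let ?T = "four_block_mat (1\<^sub>m n) P (0\<^sub>m m n) (1\<^sub>m m)"
  let ?S = "four_block_mat (1\<^sub>m n) (- P) (0\<^sub>m m n) (1\<^sub>m m)"
  let ?L = "four_block_mat (P * Q) (0\<^sub>m n m) Q (0\<^sub>m m m)"
  let ?R = "four_block_mat (0\<^sub>m n n) (0\<^sub>m n m) Q (Q * P)"
  have [simp]: "- P + P = 0\<^sub>m n m" "P + - P = 0\<^sub>m n m"
    using P by (auto intro!: eq_matI)
  have "?T * ?S = 1\<^sub>m (n + m)"
    by (subst mult_four_block_mat[of _ n n _ m _ m _ _ n _ m])
      (use P in \<open>auto simp flip: four_block_one_mat intro!: cong_four_block_mat\<close>)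
  moreover have "?S * ?T = 1\<^sub>m (n + m)"
    by (subst mult_four_block_mat[of _ n n _ m _ m _ _ n _ m])
      (use P in \<open>auto simp flip: four_block_one_mat intro!: cong_four_block_mat\<close>)
  moreover have "?T * ?R = ?L * ?T"
    by (subst (1 2) mult_four_block_mat[of _ n n _ m _ m _ _ n _ m])
      (use P Q in \<open>auto intro!: cong_four_block_mat\<close>)
  then have "?T * ?R * ?S = ?L * (?T * ?S)"
    using P Q by (simp add: assoc_mult_mat[of _ "n+m" "n+m" _ "n+m" _ "n+m"])
  ultimately have "?L = ?T * ?R * ?S"
    using P Q by (simp add: right_mult_one_mat[of _ "n+m" "n+m"])
  have "similar_mat ?L ?R"
    by (rule similar_matI[of _ _ ?T ?S "n+m"]) (fact | use P Q in simp)+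
  then have "char_poly ?L = char_poly ?R"
    by (rule char_poly_similar)
  moreover have "char_poly ?L = char_poly (P * Q) * monom 1 m"
    using P Q by (subst char_poly_four_block_upper_right_zero) (auto simp: char_poly_zero_mat)
  moreover have "char_poly ?R = monom 1 n * char_poly (Q * P)"
    using P Q by (subst char_poly_four_block_upper_right_zero) (auto simp: char_poly_zero_mat)
  ultimately show ?thesis by (simp add: mult.commute)
qed

lemma char_poly_nonzero: "A \<in> carrier_mat n n \<Longrightarrow> char_poly A \<noteq> 0"
  using degree_monic_char_poly[of A n] by auto

lemma proots_monom_one: "proots (monom 1 n :: 'a :: idom poly) = replicate_mset n 0"
proof -
  have "proots (monom 1 n :: 'a poly) = repeat_mset n {#0#}"
    using proots_linear_factor[of 0] by (simp add: monom_altdef proots_power)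
  then show ?thesis by simp
qed

text \<open>Zeros are padded on both sides, so that no assumption on which of \<open>n\<close> and
  \<open>m\<close> is larger is built in. This is the bridge from an \<open>n\<close> x
  \<open>n\<close> Gram matrix to an \<open>m\<close> x \<open>m\<close> one.\<close>

lemma proots_char_poly_mult_comm:
  fixes P :: "'a :: idom mat"
  assumes P: "P \<in> carrier_mat n m" and Q: "Q \<in> carrier_mat m n"
  shows "replicate_mset m 0 + proots (char_poly (P * Q))
       = replicate_mset n 0 + proots (char_poly (Q * P))"
proof -
  have "proots (monom 1 m * char_poly (P * Q)) = proots (monom 1 n * char_poly (Q * P))"
    using char_poly_mult_comm[OF P Q] by simp
  moreover have "char_poly (P * Q) \<noteq> 0" "char_poly (Q * P) \<noteq> 0"
    using P Q char_poly_nonzero[of "P * Q" n] char_poly_nonzero[of "Q * P" m] by auto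
  ultimately show ?thesis
    by (simp add: proots_mult proots_monom_one)
qed

lemma char_poly_mult_comm_square:
  fixes P :: "'a :: idom mat"
  assumes P: "P \<in> carrier_mat n n" and Q: "Q \<in> carrier_mat n n"
  shows "char_poly (P * Q) = char_poly (Q * P)"
  using char_poly_mult_comm[OF P Q] by simp

text \<open>Reading the eigenvalues off the characteristic polynomial makes sense for nonsymmetric
  products too. Only real roots are listed, so the list is as long as the dimension exactly when all
  eigenvalues are real.\<close>

definition eigs :: "real mat \<Rightarrow> real list" where
  "eigs M = rev (sorted_list_of_multiset (proots (char_poly M)))"

lemma rev_sorted_list_of_mset_eqI:
  assumes "\<And>i j. i \<le> j \<Longrightarrow> j < m \<Longrightarrow> d j \<le> (d i :: real)"
  shows "rev (sorted_list_of_multiset (mset (map d [0..<m]))) = map d [0..<m]"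
proof -
  have "sorted (rev (map d [0..<m]))"
    using assms by (auto simp: sorted_iff_nth_mono rev_nth)
  then have "sort (rev (map d [0..<m])) = rev (map d [0..<m])"
    by (rule sorted_sort_id)
  then show ?thesis
    by (metis mset_rev rev_rev_ident sorted_list_of_multiset_mset)
qed

lemma proots_char_poly_diagonalized:
  fixes U V :: "real mat"
  assumes U: "U \<in> carrier_mat m m" and V: "V \<in> carrier_mat m m"
    and UV: "U * V = 1\<^sub>m m" "V * U = 1\<^sub>m m"
  shows "proots (char_poly (U * mat_diag m d * V)) = mset (map d [0..<m])"
proof -
  have "similar_mat (U * mat_diag m d * V) (mat_diag m d)"
    by (rule similar_matI[of _ _ U V m]) (use assms in auto)
  then have "char_poly (U * mat_diag m d * V) = char_poly (mat_diag m d)"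
    by (rule char_poly_similar)
  also have "\<dots> = (\<Prod>a\<leftarrow>diag_mat (mat_diag m d). [:- a, 1:])"
    by (rule char_poly_upper_triangular[of _ m]) (auto simp: mat_diag_def)
  also have "diag_mat (mat_diag m d) = map d [0..<m]"
    by (rule nth_equalityI) (auto simp: diag_mat_def mat_diag_def)
  finally have *: "char_poly (U * mat_diag m d * V) = (\<Prod>a\<leftarrow>map d [0..<m]. [:- a, 1:])" .
  have "proots (\<Prod>a\<leftarrow>xs. [:- a, 1:]) = mset xs" for xs :: "real list"
  proof (induction xs)
    case (Cons x xs)
    have "(\<Prod>a\<leftarrow>xs. [:- a, 1:]) \<noteq> 0"
      by (auto simp: prod_list_zero_iff)
    then have "proots ([:- x, 1:] * (\<Prod>a\<leftarrow>xs. [:- a, 1:]))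
        = proots [:- x, 1:] + proots (\<Prod>a\<leftarrow>xs. [:- a, 1:])"
      by (intro proots_mult) auto
    with Cons show ?case by simp
  qed simp
  then show ?thesis unfolding * .
qed

lemma eigs_diagonalized:
  assumes "U \<in> carrier_mat m m" "V \<in> carrier_mat m m" "U * V = 1\<^sub>m m" "V * U = 1\<^sub>m m"
    and "\<And>i j. i \<le> j \<Longrightarrow> j < m \<Longrightarrow> d j \<le> d i"
  shows "eigs (U * mat_diag m d * V) = map d [0..<m]"
  unfolding eigs_def proots_char_poly_diagonalized[OF assms(1-4)]
  by (rule rev_sorted_list_of_mset_eqI) (rule assms(5))

section \<open>The spectral theorem for real symmetric matrices\<close>

text \<open>Over the complex numbers an eigenvalue z exists. The Hermitian form \<open>q\<close> of
  an eigenvector equals z times its squared norm \<open>s\<close>, and symmetry makes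
  \<open>q\<close> its own conjugate; so z is real and a root of the real characteristic
  polynomial.\<close>

lemma real_symmetric_has_eigenvector:
  fixes A :: "real mat"
  assumes A: "A \<in> carrier_mat n n" and sym: "transpose_mat A = A" and "n > 0"
  obtains v e where "eigenvector A v e"
proof -
  let ?C = "map_mat complex_of_real A"
  have C: "?C \<in> carrier_mat n n" using A by simp
  have "degree (char_poly ?C) = n"
    using degree_monic_char_poly[OF C] by simp
  then have "\<not> constant (poly (char_poly ?C))"
    using \<open>n > 0\<close> by (simp add: constant_degree)
  then obtain z where z: "poly (char_poly ?C) z = 0"
    using fundamental_theorem_of_algebra by blast
  then obtain v where "eigenvector ?C v z"
    using eigenvalue_root_char_poly[OF C] by (auto simp: eigenvalue_def)
  then have v: "v \<in> carrier_vec n" "v \<noteq> 0\<^sub>v n" "?C *\<^sub>v v = z \<cdot>\<^sub>v v"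
    using A by (auto simp: eigenvector_def)
  have Cv: "(\<Sum>j<n. of_real (A $$ (i,j)) * v $ j) = z * v $ i" if "i < n" for i
  proof -
    have "(?C *\<^sub>v v) $ i = (\<Sum>j<n. of_real (A $$ (i,j)) * v $ j)"
      using that A v(1) by (auto simp: scalar_prod_def atLeast0LessThan intro!: sum.cong)
    then show ?thesis using v that by simp
  qed
  define q where "q = (\<Sum>i<n. \<Sum>j<n. cnj (v $ i) * of_real (A $$ (i,j)) * v $ j)"
  define s where "s = (\<Sum>i<n. (cmod (v $ i))\<^sup>2)"
  have "q = (\<Sum>i<n. cnj (v $ i) * (z * v $ i))"
    unfolding q_def
    by (intro sum.cong refl) (simp add: Cv[symmetric] sum_distrib_left mult.assoc)
  also have "\<dots> = z * of_real s"
    unfolding s_def by (simp add: sum_distrib_left mult_ac complex_norm_square del: of_real_power)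
  finally have qz: "q = z * of_real s" .
  have "A $$ (i,j) = A $$ (j,i)" if "i < n" "j < n" for i j
    using that A sym by (metis index_transpose_mat(1) carrier_matD)
  then have "cnj q = (\<Sum>i<n. \<Sum>j<n. cnj (v $ j) * of_real (A $$ (j,i)) * v $ i)"
    unfolding q_def by (auto intro!: sum.cong)
  also have "\<dots> = q"
    unfolding q_def by (rule sum.swap)
  finally have "cnj q = q" .
  moreover have "s \<noteq> 0"
  proof
    assume "s = 0"
    then have "\<forall>i<n. v $ i = 0"
      unfolding s_def by (subst (asm) sum_nonneg_eq_0_iff) auto
    then have "v = 0\<^sub>v n" using v(1) by (intro eq_vecI) auto
    with v(2) show False by simp
  qed
  ultimately have "cnj z = z" using qz by simp
  then have z': "z = of_real (Re z)"
    by (simp add: complex_eq_iff)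
  have "char_poly ?C = map_poly of_real (char_poly A)"
    by (rule of_real_hom.char_poly_hom[OF A])
  then have "of_real (poly (char_poly A) (Re z)) = (0 :: complex)"
    using z z' by (metis of_real_hom.poly_map_poly)
  then have "eigenvalue A (Re z)"
    using eigenvalue_root_char_poly[OF A] by simp
  then show thesis
    using that by (auto simp: eigenvalue_def)
qed

lemma scalar_prod_self_pos:
  fixes v :: "real vec"
  assumes "v \<in> carrier_vec n" "v \<noteq> 0\<^sub>v n"
  shows "0 < v \<bullet> v"
  using assms conjugate_square_greater_0_vec[of v n] by (simp add: scalar_prod_def)

(* A Householder reflection maps the first basis vector to a given unit vector. *)
lemma orthogonal_mat_with_first_col:
  fixes v :: "real vec"
  assumes v: "v \<in> carrier_vec n" and unit: "v \<bullet> v = 1" and n: "0 < n"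
  obtains W where "W \<in> carrier_mat n n" "transpose_mat W * W = 1\<^sub>m n"
    "W * transpose_mat W = 1\<^sub>m n" "col W 0 = v"
proof (cases "v = unit_vec n 0")
  case True
  then show thesis using that[of "1\<^sub>m n"] n by simp
next
  case False
  define w where "w i = v $ i - (if i = 0 then 1 else 0)" for i
  define S where "S = (\<Sum>k<n. w k * w k)"
  define W where "W = mat n n (\<lambda>(i,j). (if i = j then 1 else 0) - 2 / S * w i * w j)"
  have W: "W \<in> carrier_mat n n" by (simp add: W_def)
  have sym: "transpose_mat W = W"
    by (rule eq_matI) (auto simp: W_def)
  have S0: "S \<noteq> 0"
  proof
    assume "S = 0"
    then have "\<forall>k<n. w k = 0"
      unfolding S_def by (subst (asm) sum_nonneg_eq_0_iff) auto
    then have "v = unit_vec n 0"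
      using v n by (intro eq_vecI) (auto simp: w_def unit_vec_def split: if_splits)
    with False show False by simp
  qed
  \<comment> \<open>For a unit vector \<open>v\<close>, the squared norm \<open>S\<close> of w = v -
    e_0 is -2 w_0. This identity turns column 0 of the reflection, e_0 - (2/S) w_0 w, into e_0 + w =
    v.\<close>
  have "S = (\<Sum>k<n. v $ k * v $ k - (if k = 0 then 2 * v $ 0 - 1 else 0))"
    unfolding S_def w_def by (intro sum.cong) (auto simp: algebra_simps)
  also have "\<dots> = v \<bullet> v - (2 * v $ 0 - 1)"
    using v n by (simp add: sum_subtractf scalar_prod_def atLeast0LessThan)
  finally have S: "S = 2 * (1 - v $ 0)" using unit by simp
  have "W * W = 1\<^sub>m n"
  proof (rule eq_matI)
    fix i j assume ij: "i < dim_row (1\<^sub>m n)" "j < dim_col (1\<^sub>m n :: real mat)"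
    then have "(W * W) $$ (i,j) = (\<Sum>k<n. ((if i = k then 1 else 0) - 2 / S * w i * w k)
        * ((if k = j then 1 else 0) - 2 / S * w k * w j))"
      using W by (simp add: scalar_prod_def W_def atLeast0LessThan)
    also have "\<dots> = (\<Sum>k<n. (if k = i then (if i = j then 1 else 0) - 2 / S * w i * w j else 0)
       - (if k = j then 2 / S * w i * w j else 0) + (2 / S)\<^sup>2 * w i * w j * (w k * w k))"
      by (intro sum.cong) (auto simp: power2_eq_square algebra_simps)
    also have "\<dots> = (if i = j then 1 else 0) - 2 / S * w i * w j - 2 / S * w i * w j
       + (2 / S)\<^sup>2 * w i * w j * S"
      using ij by (simp add: sum.distrib sum_subtractf flip: sum_distrib_left S_def)
    also have "\<dots> = (if i = j then 1 else 0)"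
      using S0 by (simp add: power2_eq_square field_simps)
    finally show "(W * W) $$ (i,j) = 1\<^sub>m n $$ (i,j)" using ij by simp
  qed (use W in auto)
  moreover have "col W 0 = v"
  proof (rule eq_vecI)
    fix i assume "i < dim_vec v"
    then have i: "i < n" using v by simp
    have w0: "w 0 = - S / 2" using S by (simp add: w_def)
    have "2 / S * w i * w 0 = - w i" unfolding w0 using S0 by simp
    then have "col W 0 $ i = (if i = 0 then 1 else 0) + w i"
      using i n by (simp add: W_def)
    then show "col W 0 $ i = v $ i" by (simp add: w_def)
  qed (use v W in auto)
  ultimately show thesis using that[of W] W sym by simp
qed

lemma four_block_1_carrier:
  assumes "A \<in> carrier_mat 1 1" "D \<in> carrier_mat n n"
  shows "four_block_mat A B C D \<in> carrier_mat (Suc n) (Suc n)"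
  using assms by auto

lemma mult_orthogonal:
  fixes U V :: "real mat"
  assumes U: "U \<in> carrier_mat n n" "transpose_mat U * U = 1\<^sub>m n"
    and V: "V \<in> carrier_mat n n" "transpose_mat V * V = 1\<^sub>m n"
  shows "transpose_mat (U * V) * (U * V) = 1\<^sub>m n"
proof -
  have "transpose_mat (U * V) * (U * V) = transpose_mat V * (transpose_mat U * U) * V"
    using U(1) V(1) by (simp add: transpose_mult[of _ n n _ n] assoc_mult_mat[of _ n n _ n _ n])
  then show ?thesis using U V by simp
qed

lemma congruence_mult:
  fixes W Q D :: "real mat"
  assumes "W \<in> carrier_mat n n" "Q \<in> carrier_mat n n" "D \<in> carrier_mat n n"
  shows "W * (Q * D * transpose_mat Q) * transpose_mat W = (W * Q) * D * transpose_mat (W * Q)"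
  using assms by (simp add: assoc_mult_mat[of _ n n _ n _ n] transpose_mult[of _ n n _ n])

text \<open>Deflation: in an orthonormal basis that starts with an eigenvector, column 0 of the
  matrix is a multiple of the first basis vector, and by symmetry so is row 0. What remains is a
  symmetric block of size one less. The order of the diagonal entries is left open.\<close>

lemma orthogonal_diagonalization:
  fixes A :: "real mat"
  assumes "A \<in> carrier_mat n n" and "transpose_mat A = A"
  shows "\<exists>U d. U \<in> carrier_mat n n \<and> transpose_mat U * U = 1\<^sub>m n \<and>
    A = U * mat_diag n d * transpose_mat U"
  using assms
proof (induction n arbitrary: A)
  case 0
  then show ?case
    by (intro exI[of _ "1\<^sub>m 0"] exI[of _ "\<lambda>_. 0"] conjI eq_matI) auto
next
  case (Suc n)
  note A = Suc.prems(1) and sym = Suc.prems(2)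
  let ?N = "Suc n"
  obtain u e where "eigenvector A u e"
    using real_symmetric_has_eigenvector[OF A sym] by auto
  then have u: "u \<in> carrier_vec ?N" "u \<noteq> 0\<^sub>v ?N" "A *\<^sub>v u = e \<cdot>\<^sub>v u"
    using A by (auto simp: eigenvector_def)
  define v where "v = (1 / sqrt (u \<bullet> u)) \<cdot>\<^sub>v u"
  have v: "v \<in> carrier_vec ?N" using u by (simp add: v_def)
  have unit: "v \<bullet> v = 1"
    using scalar_prod_self_pos[OF u(1,2)] u(1) by (simp add: v_def)
  have Av: "A *\<^sub>v v = e \<cdot>\<^sub>v v"
    using u A by (simp add: v_def mult_mat_vec[of _ ?N ?N] smult_smult_assoc mult.commute)
  obtain W where W: "W \<in> carrier_mat ?N ?N" "transpose_mat W * W = 1\<^sub>m ?N"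
    "W * transpose_mat W = 1\<^sub>m ?N" "col W 0 = v"
    using orthogonal_mat_with_first_col[OF v unit] by auto
  define M where "M = transpose_mat W * A * W"
  have M: "M \<in> carrier_mat ?N ?N" using W A by (simp add: M_def)
  have Msym: "transpose_mat M = M"
    using W A sym unfolding M_def
    by (simp add: transpose_mult[of _ ?N ?N _ ?N] assoc_mult_mat[of _ ?N ?N _ ?N _ ?N])
  have Mij: "M $$ (i,j) = M $$ (j,i)" if "i < ?N" "j < ?N" for i j
    using that M Msym by (metis index_transpose_mat(1) carrier_matD)
  have M0: "M $$ (i,0) = (if i = 0 then e else 0)" if i: "i < ?N" for i
  proof -
    have "M $$ (i,0) = col W i \<bullet> (A *\<^sub>v v)"
      using W A i unfolding M_def
      by (simp add: assoc_mult_mat[of _ ?N ?N _ ?N _ ?N] col_mult2[of _ ?N ?N] mult_mat_vec_def)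
    also have "\<dots> = e * (col W i \<bullet> col W 0)"
      using W v Av i by simp
    also have "col W i \<bullet> col W 0 = (transpose_mat W * W) $$ (i,0)"
      using W(1) i by simp
    finally show ?thesis using W i by simp
  qed
  define A' where "A' = mat n n (\<lambda>(i,j). M $$ (Suc i, Suc j))"
  have A': "A' \<in> carrier_mat n n" by (simp add: A'_def)
  have "transpose_mat A' = A'"
    by (rule eq_matI) (auto simp: A'_def Mij)
  then obtain U d where U: "U \<in> carrier_mat n n" "transpose_mat U * U = 1\<^sub>m n"
    "A' = U * mat_diag n d * transpose_mat U"
    using Suc.IH[OF A'] by blast
  \<comment> \<open>The direct sum of a scalar and a matrix. It respects products and transposes
    (\<open>FF\<close>, \<open>FT\<close>), so the diagonalization of the block \<open>A'\<close>
    lifts to \<open>M\<close>.\<close>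
  let ?F = "\<lambda>a. four_block_mat (mat 1 1 (\<lambda>_. a)) (0\<^sub>m 1 n) (0\<^sub>m n 1)"
  let ?d = "\<lambda>i. case i of 0 \<Rightarrow> e | Suc i \<Rightarrow> d i"
  have F: "?F a B \<in> carrier_mat ?N ?N" if "B \<in> carrier_mat n n" for a B
    using that four_block_1_carrier by auto
  have FF: "?F a B * ?F b C = ?F (a * b) (B * C)"
    if "B \<in> carrier_mat n n" "C \<in> carrier_mat n n" for a b :: real and B C
    using that by (subst mult_four_block_mat[of _ 1 1 _ n _ n _ _ 1 _ n])
      (auto intro!: cong_four_block_mat eq_matI simp: scalar_prod_def)
  have FT: "transpose_mat (?F a B) = ?F a (transpose_mat B)"
    if "B \<in> carrier_mat n n" for a :: real and B
    using that by (subst transpose_four_block_mat[of _ 1 1 _ n _ n])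
      (auto intro!: cong_four_block_mat)
  have "M = ?F e A'"
  proof (rule eq_matI)
    fix i j assume "i < dim_row (?F e A')" "j < dim_col (?F e A')"
    then have "i < ?N" "j < ?N" using A' by auto
    then show "M $$ (i,j) = ?F e A' $$ (i,j)"
      using M0 Mij[of 0 j] A' by (cases i; cases j) (auto simp: A'_def)
  qed (use M A' in auto)
  also have "\<dots> = ?F 1 U * ?F e (mat_diag n d) * ?F 1 (transpose_mat U)"
    using U FF[of U "mat_diag n d" 1 e] FF[of "U * mat_diag n d" "transpose_mat U" e 1] by simp
  also have "?F e (mat_diag n d) = mat_diag ?N ?d"
    by (rule eq_matI) (auto simp: mat_diag_def split: nat.splits)
  also have "?F 1 (transpose_mat U) = transpose_mat (?F 1 U)"
    using FT U by simp
  finally have M_eq: "M = ?F 1 U * mat_diag ?N ?d * transpose_mat (?F 1 U)" .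
  have one: "?F 1 (1\<^sub>m n) = 1\<^sub>m ?N"
    by (rule eq_matI) auto
  let ?V = "W * ?F 1 U"
  note F1U = F[OF U(1), of 1]
  have "transpose_mat (?F 1 U) * ?F 1 U = 1\<^sub>m ?N"
    using U FT FF one by simp
  then have "transpose_mat ?V * ?V = 1\<^sub>m ?N"
    by (intro mult_orthogonal W F1U)
  moreover have "A = ?V * mat_diag ?N ?d * transpose_mat ?V"
  proof -
    have "A = (W * transpose_mat W) * A * (W * transpose_mat W)"
      using W A by simp
    also have "\<dots> = W * M * transpose_mat W"
      unfolding M_def using W(1) A by (simp add: assoc_mult_mat[of _ ?N ?N _ ?N _ ?N])
    also have "\<dots> = ?V * mat_diag ?N ?d * transpose_mat ?V"
      unfolding M_eq by (rule congruence_mult[OF W(1) F1U mat_diag_dim])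
    finally show ?thesis .
  qed
  moreover have "?V \<in> carrier_mat ?N ?N" using W F1U by simp
  ultimately show ?case by blast
qed

section \<open>Monotonicity of eigenvalues\<close>

lemma mat_diag_sandwich_index:
  fixes U :: "real mat"
  assumes U: "U \<in> carrier_mat n n" and ij: "i < n" "j < n"
  shows "(U * mat_diag n d * transpose_mat U) $$ (i,j) = (\<Sum>k<n. U $$ (i,k) * d k * U $$ (j,k))"
  using assms by (simp add: mat_diag_mult_right[OF U] scalar_prod_def atLeast0LessThan)

text \<open>The diagonal entries of any diagonalization and the list \<open>eigs A\<close> are the
  same multiset of roots, hence differ by a permutation \<open>p\<close>. Permuting the columns of
  \<open>U\<close> by \<open>p\<close> keeps them orthonormal and puts the diagonal in descending
  order.\<close>

lemma symmetric_spectral: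
  fixes A :: "real mat"
  assumes A: "A \<in> carrier_mat n n" "transpose_mat A = A"
  obtains U where "U \<in> carrier_mat n n" "transpose_mat U * U = 1\<^sub>m n" "U * transpose_mat U = 1\<^sub>m n"
    "A = U * mat_diag n (\<lambda>i. eigs A ! i) * transpose_mat U" "length (eigs A) = n"
proof -
  obtain U d where U: "U \<in> carrier_mat n n" "transpose_mat U * U = 1\<^sub>m n"
    "A = U * mat_diag n d * transpose_mat U"
    using orthogonal_diagonalization[OF A] by blast
  have UU: "U * transpose_mat U = 1\<^sub>m n"
    using mat_mult_left_right_inverse[of "transpose_mat U" n U] U by simp
  have "mset (eigs A) = mset (map d [0..<n])"
    unfolding eigs_def by (subst U(3), subst proots_char_poly_diagonalized) (use U UU in auto)
  then obtain p where "p permutes {..<length (map d [0..<n])}"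
      and perm: "permute_list p (map d [0..<n]) = eigs A"
    by (rule mset_eq_permutation)
  then have p: "p permutes {..<n}" by simp
  have len: "length (eigs A) = n"
    using arg_cong[OF perm, of length] by simp
  have pn: "p i < n" if "i < n" for i
    using p that permutes_in_image[OF p] by auto
  have e: "eigs A ! i = d (p i)" if "i < n" for i
    using that p pn by (simp flip: perm add: permute_list_nth)
  define V where "V = mat n n (\<lambda>(i,j). U $$ (i, p j))"
  have V: "V \<in> carrier_mat n n" by (simp add: V_def)
  have VV: "transpose_mat V * V = 1\<^sub>m n"
  proof (rule eq_matI)
    fix i j assume "i < dim_row (1\<^sub>m n :: real mat)" "j < dim_col (1\<^sub>m n :: real mat)"
    then have ij: "i < n" "j < n" by auto
    then have "(transpose_mat V * V) $$ (i,j) = (transpose_mat U * U) $$ (p i, p j)"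
      using U(1) pn by (simp add: V_def scalar_prod_def)
    also have "\<dots> = 1\<^sub>m n $$ (i,j)"
      using U(2) ij pn permutes_inj[OF p] by (auto simp: inj_eq)
    finally show "(transpose_mat V * V) $$ (i,j) = 1\<^sub>m n $$ (i,j)" .
  qed (use V in auto)
  have "A = V * mat_diag n (\<lambda>i. eigs A ! i) * transpose_mat V"
  proof (rule eq_matI)
    fix i j assume "i < dim_row (V * mat_diag n (\<lambda>i. eigs A ! i) * transpose_mat V)"
      "j < dim_col (V * mat_diag n (\<lambda>i. eigs A ! i) * transpose_mat V)"
    then have ij: "i < n" "j < n" using V by auto
    have "A $$ (i,j) = (\<Sum>k<n. U $$ (i,k) * d k * U $$ (j,k))"
      by (subst U(3)) (rule mat_diag_sandwich_index[OF U(1) ij])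
    also have "\<dots> = (\<Sum>k<n. U $$ (i, p k) * d (p k) * U $$ (j, p k))"
      by (subst sum.permute[OF p]) simp
    also have "\<dots> = (\<Sum>k<n. V $$ (i,k) * eigs A ! k * V $$ (j,k))"
      using ij by (intro sum.cong) (auto simp: V_def e)
    finally show "A $$ (i,j) = (V * mat_diag n (\<lambda>i. eigs A ! i) * transpose_mat V) $$ (i,j)"
      unfolding mat_diag_sandwich_index[OF V ij] .
  qed (use A V in auto)
  moreover have "V * transpose_mat V = 1\<^sub>m n"
    using mat_mult_left_right_inverse[of "transpose_mat V" n V] V VV by simp
  ultimately show thesis using that V VV len by blast
qed

lemma length_eigs:
  assumes "A \<in> carrier_mat n n" "transpose_mat A = A"
  shows "length (eigs A) = n"
  by (rule symmetric_spectral[OF assms])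

lemma eigs_antimono:
  assumes "A \<in> carrier_mat n n" "transpose_mat A = A" "i \<le> j" "j < n"
  shows "eigs A ! j \<le> eigs A ! i"
proof -
  have "sorted (sorted_list_of_multiset (proots (char_poly A)))"
    by (metis ex_mset sorted_list_of_multiset_mset sorted_sort)
  then have "sorted (rev (eigs A))" by (simp add: eigs_def)
  then show ?thesis
    using assms length_eigs[OF assms(1,2)] sorted_rev_nth_mono by blast
qed

lemma quadratic_form_diagonalized:
  fixes U :: "real mat"
  assumes U: "U \<in> carrier_mat n n" and v: "v \<in> carrier_vec n"
  shows "v \<bullet> ((U * mat_diag n d * transpose_mat U) *\<^sub>v v) = (\<Sum>i<n. d i * ((transpose_mat U *\<^sub>v v) $ i)\<^sup>2)"
proof -
  define w where "w = transpose_mat U *\<^sub>v v"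
  have w: "w \<in> carrier_vec n" using U v by (simp add: w_def)
  have "mat_diag n d *\<^sub>v w = vec n (\<lambda>i. d i * w $ i)"
  proof (rule eq_vecI)
    fix i assume i: "i < dim_vec (vec n (\<lambda>i. d i * w $ i))"
    have "(mat_diag n d *\<^sub>v w) $ i = (\<Sum>k<n. (if i = k then d k else 0) * w $ k)"
      using w i by (simp add: mat_diag_def scalar_prod_def atLeast0LessThan)
    also have "\<dots> = (\<Sum>k<n. if k = i then d k * w $ k else 0)"
      by (intro sum.cong) auto
    finally show "(mat_diag n d *\<^sub>v w) $ i = vec n (\<lambda>i. d i * w $ i) $ i"
      using i by simp
  qed (simp add: mat_diag_def)
  moreover have "(U * mat_diag n d * transpose_mat U) *\<^sub>v v = U *\<^sub>v (mat_diag n d *\<^sub>v w)"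
    using U v by (simp add: w_def assoc_mult_mat_vec[of _ n n _ n])
  moreover have "v \<bullet> (U *\<^sub>v x) = w \<bullet> x" if "x \<in> carrier_vec n" for x
    unfolding w_def using transpose_vec_mult_scalar[OF U that v] by simp
  ultimately have "v \<bullet> ((U * mat_diag n d * transpose_mat U) *\<^sub>v v) = w \<bullet> vec n (\<lambda>i. d i * w $ i)"
    by simp
  also have "\<dots> = (\<Sum>i<n. d i * (w $ i)\<^sup>2)"
    by (auto simp: scalar_prod_def atLeast0LessThan power2_eq_square intro!: sum.cong)
  finally show ?thesis unfolding w_def .
qed

lemma norm_square_orthogonal:
  fixes U :: "real mat"
  assumes U: "U \<in> carrier_mat n n" "U * transpose_mat U = 1\<^sub>m n" and v: "v \<in> carrier_vec n"
  shows "v \<bullet> v = (\<Sum>i<n. ((transpose_mat U *\<^sub>v v) $ i)\<^sup>2)"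
proof -
  have "U * mat_diag n (\<lambda>_. 1) * transpose_mat U = 1\<^sub>m n" using U by simp
  then show ?thesis
    using quadratic_form_diagonalized[OF U(1) v, of "\<lambda>_. 1"] v by simp
qed

text \<open>A dimension count: i + (n - 1 - i) = n - 1 homogeneous conditions on n unknowns have a
  nonzero solution. The conditions are the rows of \<open>N\<close>, with a zero row at the free
  index \<open>i\<close>.\<close>

lemma ex_solution_first_coordinates:
  fixes G :: "real mat"
  assumes G: "G \<in> carrier_mat n n" and i: "i < n"
  obtains y :: "real vec" where "y \<in> carrier_vec n" "y \<noteq> 0\<^sub>v n"
    "\<And>j. j < i \<Longrightarrow> (G *\<^sub>v y) $ j = 0" "\<And>j. i < j \<Longrightarrow> j < n \<Longrightarrow> y $ j = 0"
proof -
  define N where "N = mat n n (\<lambda>(j,l). if j < i then G $$ (j,l) else if j = i then 0 else if j = l then 1 else 0)"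
  have N: "N \<in> carrier_mat n n" by (simp add: N_def)
  \<comment> \<open>Row \<open>i\<close> is zero, so scaling it by 0 changes nothing, while it
    multiplies the determinant by 0.\<close>
  have "N = multrow i 0 N"
    by (rule eq_matI) (auto simp: N_def)
  then have "det N = 0 * det N"
    using det_multrow[OF i N, of 0] by simp
  then obtain y where y: "y \<in> carrier_vec n" "y \<noteq> 0\<^sub>v n" "N *\<^sub>v y = 0\<^sub>v n"
    using det_0_iff_vec_prod_zero[OF N] by auto
  have "(G *\<^sub>v y) $ j = 0" if "j < i" for j
  proof -
    have "(G *\<^sub>v y) $ j = (N *\<^sub>v y) $ j"
      using that i G y(1) by (auto simp: N_def scalar_prod_def intro!: sum.cong)
    then show ?thesis using y(3) that i by simp
  qed
  moreover have "y $ j = 0" if "i < j" "j < n" for j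
  proof -
    have "(N *\<^sub>v y) $ j = (\<Sum>l<n. (if j = l then 1 else 0) * y $ l)"
      using that y(1) by (simp add: N_def scalar_prod_def atLeast0LessThan)
    also have "\<dots> = (\<Sum>l<n. if l = j then y $ l else 0)"
      by (intro sum.cong) auto
    finally show ?thesis using y(3) that by simp
  qed
  ultimately show thesis using that y(1,2) by blast
qed

(* Weyl's monotonicity principle: the span of the first i + 1 eigenvectors of S meets the
   span of the eigenvectors of T from index i on. *)
lemma eigs_mono:
  fixes S T :: "real mat"
  assumes S: "S \<in> carrier_mat n n" "transpose_mat S = S"
    and T: "T \<in> carrier_mat n n" "transpose_mat T = T"
    and le: "\<And>v. v \<in> carrier_vec n \<Longrightarrow> v \<bullet> (S *\<^sub>v v) \<le> v \<bullet> (T *\<^sub>v v)"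
    and i: "i < n"
  shows "eigs S ! i \<le> eigs T ! i"
proof -
  let ?s = "\<lambda>i. eigs S ! i" and ?t = "\<lambda>i. eigs T ! i"
  obtain U where U: "U \<in> carrier_mat n n" "transpose_mat U * U = 1\<^sub>m n" "U * transpose_mat U = 1\<^sub>m n"
    "S = U * mat_diag n ?s * transpose_mat U"
    by (rule symmetric_spectral[OF S])
  obtain W where W: "W \<in> carrier_mat n n" "transpose_mat W * W = 1\<^sub>m n" "W * transpose_mat W = 1\<^sub>m n"
    "T = W * mat_diag n ?t * transpose_mat W"
    by (rule symmetric_spectral[OF T])
  \<comment> \<open>Here \<open>y\<close> holds coordinates in the eigenbasis of \<open>S\<close>;
    the matrix \<open>transpose_mat W * U\<close> converts them to coordinates in the eigenbasis of
    \<open>T\<close>.\<close>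
  obtain y :: "real vec" where y: "y \<in> carrier_vec n" "y \<noteq> 0\<^sub>v n"
    "\<And>j. j < i \<Longrightarrow> ((transpose_mat W * U) *\<^sub>v y) $ j = 0" "\<And>j. i < j \<Longrightarrow> j < n \<Longrightarrow> y $ j = 0"
    using ex_solution_first_coordinates[of "transpose_mat W * U" n i] U(1) W(1) i by auto
  define v where "v = U *\<^sub>v y"
  have v: "v \<in> carrier_vec n" using U y by (simp add: v_def)
  have Uv: "transpose_mat U *\<^sub>v v = y"
    unfolding v_def using U y(1) by (simp flip: assoc_mult_mat_vec[of _ n n _ n])
  have Wv: "(transpose_mat W *\<^sub>v v) $ j = 0" if "j < i" for j
    using y(3)[OF that] U(1) W(1) y(1) by (simp add: v_def)
  have "0 < v \<bullet> v"
    using scalar_prod_self_pos[OF v] Uv y(2) U(1) by fastforce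
  have "?s i * (v \<bullet> v) = (\<Sum>j<n. ?s i * (y $ j)\<^sup>2)"
    unfolding norm_square_orthogonal[OF U(1,3) v] Uv by (simp add: sum_distrib_left)
  also have "\<dots> \<le> (\<Sum>j<n. ?s j * (y $ j)\<^sup>2)"
  proof (rule sum_mono)
    fix j assume "j \<in> {..<n}"
    then show "?s i * (y $ j)\<^sup>2 \<le> ?s j * (y $ j)\<^sup>2"
      using y(4)[of j] eigs_antimono[OF S, of j i] i by (cases "i < j") (auto intro: mult_right_mono)
  qed
  also have "\<dots> = v \<bullet> (S *\<^sub>v v)"
    by (subst U(4)) (simp add: quadratic_form_diagonalized[OF U(1) v] Uv)
  also have "\<dots> \<le> v \<bullet> (T *\<^sub>v v)" by (rule le[OF v])
  also have "\<dots> = (\<Sum>j<n. ?t j * ((transpose_mat W *\<^sub>v v) $ j)\<^sup>2)"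
    by (subst W(4)) (rule quadratic_form_diagonalized[OF W(1) v])
  also have "\<dots> \<le> (\<Sum>j<n. ?t i * ((transpose_mat W *\<^sub>v v) $ j)\<^sup>2)"
  proof (rule sum_mono)
    fix j assume "j \<in> {..<n}"
    then show "?t j * ((transpose_mat W *\<^sub>v v) $ j)\<^sup>2 \<le> ?t i * ((transpose_mat W *\<^sub>v v) $ j)\<^sup>2"
      using Wv[of j] eigs_antimono[OF T, of i j] i by (cases "j < i") (auto intro: mult_right_mono)
  qed
  also have "\<dots> = ?t i * (v \<bullet> v)"
    unfolding norm_square_orthogonal[OF W(1,3) v] by (simp add: sum_distrib_left)
  finally show ?thesis using \<open>0 < v \<bullet> v\<close> by simp
qed

section \<open>Determinants as products of eigenvalues\<close>

lemma det_mat_diag: "det (mat_diag n d) = (\<Prod>i<n. d i :: 'a :: comm_ring_1)"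
proof -
  have "upper_triangular (mat_diag n d)" by (auto simp: mat_diag_def)
  then have "det (mat_diag n d) = prod_list (diag_mat (mat_diag n d))"
    by (rule det_upper_triangular[of _ n]) simp
  also have "diag_mat (mat_diag n d) = map d [0..<n]"
    by (rule nth_equalityI) (auto simp: diag_mat_def mat_diag_def)
  finally show ?thesis by (simp add: prod.list_conv_set_nth atLeast0LessThan)
qed

lemma det_diagonalized:
  fixes U :: "real mat"
  assumes U: "U \<in> carrier_mat n n" "transpose_mat U * U = 1\<^sub>m n"
  shows "det (U * mat_diag n d * transpose_mat U) = (\<Prod>i<n. d i)"
proof -
  have "det (transpose_mat U) * det U = 1"
    using U det_mult[of "transpose_mat U" n U] by simp
  then have "det U * det U = 1" using det_transpose[OF U(1)] by simp
  moreover have "det (U * mat_diag n d * transpose_mat U) = det U * (\<Prod>i<n. d i) * det U"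
    using U(1) by (simp add: det_mult[of _ n] det_transpose det_mat_diag)
  ultimately show ?thesis by (metis mult.commute mult.left_commute mult.right_neutral)
qed

lemma det_eq_prod_eigs:
  assumes "A \<in> carrier_mat n n" "transpose_mat A = A"
  shows "det A = (\<Prod>i<n. eigs A ! i)"
proof -
  obtain U where U: "U \<in> carrier_mat n n" "transpose_mat U * U = 1\<^sub>m n"
    "A = U * mat_diag n (\<lambda>i. eigs A ! i) * transpose_mat U"
    by (rule symmetric_spectral[OF assms])
  show ?thesis by (subst U(3)) (rule det_diagonalized[OF U(1,2)])
qed

section \<open>Multiplicative Lidskii inequality\<close>

lemma smult_mat_mult_vec:
  "A \<in> carrier_mat m n \<Longrightarrow> v \<in> carrier_vec n \<Longrightarrow> (t \<cdot>\<^sub>m A) *\<^sub>v v = (t :: real) \<cdot>\<^sub>v (A *\<^sub>v v)"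
  by (rule eq_vecI) auto

lemma transpose_smult_mat: "transpose_mat (t \<cdot>\<^sub>m A) = t \<cdot>\<^sub>m transpose_mat A"
  by (rule eq_matI) auto

lemma mult_mat_zero_vec: "A \<in> carrier_mat m n \<Longrightarrow> A *\<^sub>v 0\<^sub>v n = (0\<^sub>v m :: real vec)"
  by (rule eq_vecI) auto

section \<open>Positive definite and semidefinite matrices, congruence and shifts\<close>

definition pos_semidef :: "nat \<Rightarrow> real mat \<Rightarrow> bool" where
  "pos_semidef n A \<longleftrightarrow> A \<in> carrier_mat n n \<and> transpose_mat A = A \<and>
    (\<forall>v\<in>carrier_vec n. 0 \<le> v \<bullet> (A *\<^sub>v v))"

definition pos_def :: "nat \<Rightarrow> real mat \<Rightarrow> bool" where
  "pos_def n A \<longleftrightarrow> A \<in> carrier_mat n n \<and> transpose_mat A = A \<and>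
    (\<forall>v\<in>carrier_vec n. v \<noteq> 0\<^sub>v n \<longrightarrow> 0 < v \<bullet> (A *\<^sub>v v))"

lemma pos_semidefD:
  assumes "pos_semidef n A"
  shows "A \<in> carrier_mat n n" "transpose_mat A = A" "v \<in> carrier_vec n \<Longrightarrow> 0 \<le> v \<bullet> (A *\<^sub>v v)"
  using assms by (auto simp: pos_semidef_def)

lemma pos_defD:
  assumes "pos_def n A"
  shows "A \<in> carrier_mat n n" "transpose_mat A = A"
    "v \<in> carrier_vec n \<Longrightarrow> v \<noteq> 0\<^sub>v n \<Longrightarrow> 0 < v \<bullet> (A *\<^sub>v v)"
  using assms by (auto simp: pos_def_def)

lemma pos_def_imp_pos_semidef: "pos_def n A \<Longrightarrow> pos_semidef n A"
  unfolding pos_def_def pos_semidef_def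
  by (metis order.refl less_imp_le mult_mat_vec_carrier scalar_prod_left_zero)

text \<open>The vector is the column of \<open>U\<close> with index \<open>i\<close>, an eigenvector
  of norm 1. It transfers the sign of the quadratic form to each eigenvalue.\<close>

lemma eigs_eq_quadratic_form:
  assumes A: "A \<in> carrier_mat n n" "transpose_mat A = A" and i: "i < n"
  obtains v where "v \<in> carrier_vec n" "v \<noteq> 0\<^sub>v n" "v \<bullet> (A *\<^sub>v v) = eigs A ! i"
proof -
  obtain U where U: "U \<in> carrier_mat n n" "transpose_mat U * U = 1\<^sub>m n"
    "A = U * mat_diag n (\<lambda>i. eigs A ! i) * transpose_mat U"
    by (rule symmetric_spectral[OF A])
  define v where "v = U *\<^sub>v unit_vec n i"
  have v: "v \<in> carrier_vec n" using U by (simp add: v_def)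
  have Uv: "transpose_mat U *\<^sub>v v = unit_vec n i"
    unfolding v_def using U by (simp flip: assoc_mult_mat_vec[of _ n n _ n])
  have "v \<bullet> (A *\<^sub>v v) = (\<Sum>j<n. eigs A ! j * (unit_vec n i $ j)\<^sup>2)"
    by (subst U(3)) (simp only: quadratic_form_diagonalized[OF U(1) v] Uv)
  also have "\<dots> = (\<Sum>j<n. if j = i then eigs A ! j else 0)"
    by (intro sum.cong) (auto simp: unit_vec_def)
  also have "\<dots> = eigs A ! i" using i by simp
  finally have "v \<bullet> (A *\<^sub>v v) = eigs A ! i" .
  moreover have "v \<noteq> 0\<^sub>v n"
  proof
    assume "v = 0\<^sub>v n"
    then have "unit_vec n i = (0\<^sub>v n :: real vec)"
      using Uv U(1) mult_mat_zero_vec[of "transpose_mat U" n n] by simp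
    then show False using i by (metis index_unit_vec(1) index_zero_vec(1) zero_neq_one)
  qed
  ultimately show thesis using that v by blast
qed

lemma eigs_nonneg: "pos_semidef n A \<Longrightarrow> i < n \<Longrightarrow> 0 \<le> eigs A ! i"
  by (metis eigs_eq_quadratic_form pos_semidefD)

lemma eigs_pos: "pos_def n A \<Longrightarrow> i < n \<Longrightarrow> 0 < eigs A ! i"
  by (metis eigs_eq_quadratic_form pos_defD)

lemma transpose_congruence:
  fixes A R :: "real mat"
  assumes "A \<in> carrier_mat n n" "transpose_mat A = A" "R \<in> carrier_mat n k"
  shows "transpose_mat (transpose_mat R * A * R) = transpose_mat R * A * R"
  using assms by (simp add: transpose_mult[of _ k n _ k] transpose_mult[of _ n n _ k]
      assoc_mult_mat[of _ k n _ n _ k])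

lemma quadratic_form_congruence:
  fixes A R :: "real mat"
  assumes A: "A \<in> carrier_mat n n" and R: "R \<in> carrier_mat n k" and v: "v \<in> carrier_vec k"
  shows "v \<bullet> ((transpose_mat R * A * R) *\<^sub>v v) = (R *\<^sub>v v) \<bullet> (A *\<^sub>v (R *\<^sub>v v))"
proof -
  have "(transpose_mat R * A * R) *\<^sub>v v = transpose_mat R *\<^sub>v (A *\<^sub>v (R *\<^sub>v v))"
    using A R v by (simp add: assoc_mult_mat_vec[of _ k n _ k] assoc_mult_mat_vec[of _ k n _ n])
  moreover have "v \<bullet> (transpose_mat R *\<^sub>v w) = (R *\<^sub>v v) \<bullet> w" if "w \<in> carrier_vec n" for w
    using transpose_vec_mult_scalar[of "transpose_mat R" k n w v] that R v by simp
  ultimately show ?thesis using A R v by simp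
qed

lemma pos_semidef_congruence:
  assumes A: "pos_semidef n A" and R: "R \<in> carrier_mat n k"
  shows "pos_semidef k (transpose_mat R * A * R)"
  unfolding pos_semidef_def
  using pos_semidefD[OF A] R transpose_congruence[of A n R k] quadratic_form_congruence[of A n R k]
  by auto

lemma pos_def_congruence:
  assumes A: "pos_def n A" and R: "R \<in> carrier_mat n n" and S: "S \<in> carrier_mat n n" "S * R = 1\<^sub>m n"
  shows "pos_def n (transpose_mat R * A * R)"
  unfolding pos_def_def
proof (intro conjI ballI impI)
  fix v :: "real vec" assume v: "v \<in> carrier_vec n" "v \<noteq> 0\<^sub>v n"
  have "R *\<^sub>v v \<noteq> 0\<^sub>v n"
  proof
    assume "R *\<^sub>v v = 0\<^sub>v n"
    then have "(S * R) *\<^sub>v v = 0\<^sub>v n"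
      using S(1) R v mult_mat_zero_vec[OF S(1)] by simp
    then show False using S v by simp
  qed
  then show "0 < v \<bullet> ((transpose_mat R * A * R) *\<^sub>v v)"
    using quadratic_form_congruence[OF pos_defD(1)[OF A] R v(1)] pos_defD(3)[OF A, of "R *\<^sub>v v"] R v
    by simp
qed (use pos_defD[OF A] R transpose_congruence[of A n R n] in auto)

lemma pos_def_one: "pos_def n (1\<^sub>m n)"
  unfolding pos_def_def using scalar_prod_self_pos by auto

lemma eigs_smult:
  assumes A: "A \<in> carrier_mat n n" "transpose_mat A = A" and t: "0 \<le> t" and i: "i < n"
  shows "eigs (t \<cdot>\<^sub>m A) ! i = t * eigs A ! i"
proof -
  obtain U where U: "U \<in> carrier_mat n n" "transpose_mat U * U = 1\<^sub>m n" "U * transpose_mat U = 1\<^sub>m n"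
    "A = U * mat_diag n (\<lambda>i. eigs A ! i) * transpose_mat U"
    by (rule symmetric_spectral[OF A])
  have "t \<cdot>\<^sub>m mat_diag n (\<lambda>i. eigs A ! i) = mat_diag n (\<lambda>i. t * eigs A ! i)"
    by (rule eq_matI) (auto simp: mat_diag_def)
  then have "U * mat_diag n (\<lambda>i. t * eigs A ! i) * transpose_mat U
      = t \<cdot>\<^sub>m (U * mat_diag n (\<lambda>i. eigs A ! i) * transpose_mat U)"
    using U(1) by (simp add: mult_smult_assoc_mat[of _ n n _ n] mult_smult_distrib[of _ n n _ n] flip: \<open>t \<cdot>\<^sub>m _ = _\<close>)
  then have "t \<cdot>\<^sub>m A = U * mat_diag n (\<lambda>i. t * eigs A ! i) * transpose_mat U"
    using U(4) by simp
  then have "eigs (t \<cdot>\<^sub>m A) = map (\<lambda>i. t * eigs A ! i) [0..<n]"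
    using U eigs_antimono[OF A] t by (simp add: eigs_diagonalized mult_left_mono)
  then show ?thesis using i by simp
qed

lemma eigs_add_one_smult:
  assumes A: "A \<in> carrier_mat n n" "transpose_mat A = A" and i: "i < n"
  shows "eigs (A + t \<cdot>\<^sub>m 1\<^sub>m n) ! i = eigs A ! i + t"
proof -
  obtain U where U: "U \<in> carrier_mat n n" "transpose_mat U * U = 1\<^sub>m n" "U * transpose_mat U = 1\<^sub>m n"
    "A = U * mat_diag n (\<lambda>i. eigs A ! i) * transpose_mat U"
    by (rule symmetric_spectral[OF A])
  have "mat_diag n (\<lambda>i. eigs A ! i + t) = mat_diag n (\<lambda>i. eigs A ! i) + t \<cdot>\<^sub>m 1\<^sub>m n"
    by (rule eq_matI) (auto simp: mat_diag_def)
  then have "U * mat_diag n (\<lambda>i. eigs A ! i + t) * transpose_mat U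
      = U * mat_diag n (\<lambda>i. eigs A ! i) * transpose_mat U + t \<cdot>\<^sub>m (U * transpose_mat U)"
    using U(1) by (simp add: mult_add_distrib_mat[of _ n n _ n] add_mult_distrib_mat[of _ n n _ _ n]
        mult_smult_assoc_mat[of _ n n _ n] mult_smult_distrib[of _ n n _ n])
  also have "\<dots> = A + t \<cdot>\<^sub>m 1\<^sub>m n" using U(3,4) by simp
  finally have "eigs (A + t \<cdot>\<^sub>m 1\<^sub>m n) = map (\<lambda>i. eigs A ! i + t) [0..<n]"
    using U eigs_antimono[OF A] by (metis (no_types, lifting) add_right_mono eigs_diagonalized transpose_carrier_mat)
  then show ?thesis using i by simp
qed

(* Li-Mathias: raising the eigenvalues of A below the card I-th one to that value t leaves the
   right-hand side unchanged, increases the left-hand side, and makes A dominate t, so that every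
   ratio of eigenvalues is at least t and the product over I is bounded through determinants. *)
lemma prod_eigs_congruence_le:
  fixes A R S :: "real mat"
  assumes A: "pos_def n A" and R: "R \<in> carrier_mat n n" and S: "S \<in> carrier_mat n n" "S * R = 1\<^sub>m n"
    and I: "I \<subseteq> {..<n}"
  shows "(\<Prod>i\<in>I. eigs (transpose_mat R * A * R) ! i)
    \<le> (\<Prod>i\<in>I. eigs (transpose_mat R * R) ! i) * (\<Prod>j<card I. eigs A ! j)"
proof (cases "I = {}")
  case False
  note Ac = pos_defD(1,2)[OF A]
  have fin: "finite I" using I finite_subset by blast
  have k: "0 < card I" "card I \<le> n"
    using False fin card_mono[OF _ I] by (auto simp: card_gt_0_iff)
  define k where "k = card I"
  define a where "a = (!) (eigs A)"
  define t where "t = a (k - 1)"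
  have t: "0 < t" using eigs_pos[OF A, of "k - 1"] k by (simp add: t_def a_def k_def)
  obtain U where U: "U \<in> carrier_mat n n" "transpose_mat U * U = 1\<^sub>m n" "U * transpose_mat U = 1\<^sub>m n"
    "A = U * mat_diag n a * transpose_mat U"
    by (rule symmetric_spectral[OF Ac, folded a_def])
  define B where "B = U * mat_diag n (\<lambda>i. max (a i) t) * transpose_mat U"
  have B: "B \<in> carrier_mat n n"
    unfolding B_def using U(1) by (intro mult_carrier_mat[of _ n n]) auto
  have Bsym: "transpose_mat B = B"
  proof (rule eq_matI)
    fix i j assume "i < dim_row B" "j < dim_col B"
    then have ij: "i < n" "j < n" using B by auto
    then have "transpose_mat B $$ (i,j) = B $$ (j,i)" using B by simp
    then show "transpose_mat B $$ (i,j) = B $$ (i,j)"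
      unfolding B_def mat_diag_sandwich_index[OF U(1) ij] mat_diag_sandwich_index[OF U(1) ij(2,1)]
      by (simp add: mult_ac)
  qed (use B in auto)
  have AB: "v \<bullet> (A *\<^sub>v v) \<le> v \<bullet> (B *\<^sub>v v)" if v: "v \<in> carrier_vec n" for v
    unfolding B_def by (subst U(4), unfold quadratic_form_diagonalized[OF U(1) v])
      (intro sum_mono mult_right_mono, auto)
  have tB: "t * (v \<bullet> v) \<le> v \<bullet> (B *\<^sub>v v)" if v: "v \<in> carrier_vec n" for v
    unfolding B_def quadratic_form_diagonalized[OF U(1) v] norm_square_orthogonal[OF U(1,3) v]
      sum_distrib_left
    by (intro sum_mono mult_right_mono) auto
  let ?RA = "transpose_mat R * A * R" and ?RB = "transpose_mat R * B * R"
    and ?RR = "transpose_mat R * R"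
  define x where "x i = eigs ?RA ! i" for i
  define y where "y i = eigs ?RB ! i" for i
  define z where "z i = eigs ?RR ! i" for i
  have RA: "?RA \<in> carrier_mat n n" "transpose_mat ?RA = ?RA"
    using R Ac transpose_congruence[OF Ac R] by auto
  have RB: "?RB \<in> carrier_mat n n" "transpose_mat ?RB = ?RB"
    using R B transpose_congruence[OF B Bsym R] by auto
  have "pos_def n (transpose_mat R * 1\<^sub>m n * R)"
    by (rule pos_def_congruence[OF pos_def_one R S])
  then have RR: "pos_def n ?RR" using R by simp
  note RRc = pos_defD(1,2)[OF RR]
  have Rv: "R *\<^sub>v v \<in> carrier_vec n" if "v \<in> carrier_vec n" for v using R that by simp
  have x0: "0 \<le> x i" if "i < n" for i
    using eigs_nonneg[OF pos_semidef_congruence[OF pos_def_imp_pos_semidef[OF A] R] that] by (simp add: x_def)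
  have z0: "0 < z i" if "i < n" for i using eigs_pos[OF RR that] by (simp add: z_def)
  have xy: "x i \<le> y i" if "i < n" for i
    unfolding x_def y_def
    by (rule eigs_mono[OF RA RB _ that])
      (simp only: quadratic_form_congruence[OF Ac(1) R] quadratic_form_congruence[OF B R] AB Rv)
  \<comment> \<open>\<open>B\<close> dominates t times the identity, so its congruence by
    \<open>R\<close> dominates \<open>t \<cdot>\<^sub>m ?RR\<close>, and monotonicity applies index
    by index.\<close>
  have zy: "t * z i \<le> y i" if "i < n" for i
  proof -
    have "eigs (t \<cdot>\<^sub>m ?RR) ! i \<le> y i"
      unfolding y_def
    proof (rule eigs_mono[OF _ _ RB _ that])
      fix v :: "real vec" assume v: "v \<in> carrier_vec n"
      have "v \<bullet> ((t \<cdot>\<^sub>m ?RR) *\<^sub>v v) = t * ((R *\<^sub>v v) \<bullet> (R *\<^sub>v v))"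
        using quadratic_form_congruence[OF one_carrier_mat R v] R v RRc(1) Rv[OF v]
        by (simp add: smult_mat_mult_vec[of _ n n])
      then show "v \<bullet> ((t \<cdot>\<^sub>m ?RR) *\<^sub>v v) \<le> v \<bullet> (?RB *\<^sub>v v)"
        using tB[OF Rv[OF v]] by (simp only: quadratic_form_congruence[OF B R v])
    qed (use RRc transpose_smult_mat[of t ?RR] in simp_all)
    then show ?thesis using eigs_smult[OF RRc less_imp_le[OF t] that] by (simp add: z_def)
  qed
  have ratio: "1 \<le> y i / (t * z i)" if "i < n" for i
    using zy[OF that] z0[OF that] t by simp
  have "det ?RB = det ?RR * det B"
    using R B by (simp add: det_mult[of _ n] det_transpose)
  then have prod_y: "(\<Prod>i<n. y i) = (\<Prod>i<n. z i) * (\<Prod>i<n. max (a i) t)"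
    unfolding det_eq_prod_eigs[OF RB] det_eq_prod_eigs[OF RRc]
    by (simp add: y_def z_def B_def det_diagonalized[OF U(1,2)])
  have prod_z: "0 < (\<Prod>i<n. z i)" by (intro prod_pos) (auto intro: z0)
  have at: "t \<le> a i" if "i < k" for i
    unfolding t_def a_def by (rule eigs_antimono[OF Ac]) (use that k in \<open>auto simp: k_def\<close>)
  have ta: "a i \<le> t" if "k \<le> i" "i < n" for i
    unfolding t_def a_def by (rule eigs_antimono[OF Ac]) (use that k in \<open>auto simp: k_def\<close>)
  \<comment> \<open>All ratios are at least 1, so passing from \<open>I\<close> to all indices can
    only increase the product; over all indices the determinants of \<open>?RB\<close>,
    \<open>?RR\<close> and \<open>B\<close> evaluate it.\<close>
  have "(\<Prod>i\<in>I. y i / (t * z i)) \<le> (\<Prod>i<n. y i / (t * z i))"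
  proof (rule prod_mono2)
    fix i assume "i \<in> I"
    then show "0 \<le> y i / (t * z i)" using I ratio[of i] by auto
  qed (use I ratio in auto)
  also have "\<dots> = (\<Prod>i<n. max (a i) t / t)"
    using prod_z prod_y z0 by (auto simp: prod_dividef prod.distrib field_simps dest: less_imp_neq)
  \<comment> \<open>From index \<open>k\<close> on the maximum is \<open>t\<close> and the factor is
    1; below \<open>k\<close> it is \<open>a i\<close>.\<close>
  also have "\<dots> = (\<Prod>i<k. a i / t)"
    by (rule prod.mono_neutral_cong_right) (use k t at ta in \<open>auto simp: k_def max_def not_less intro: order.antisym\<close>)
  finally have *: "(\<Prod>i\<in>I. y i / (t * z i)) \<le> (\<Prod>i<k. a i / t)" .
  have "(\<Prod>i\<in>I. x i) \<le> (\<Prod>i\<in>I. y i)"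
    by (intro prod_mono) (use I x0 xy in auto)
  also have "\<dots> = (\<Prod>i\<in>I. z i) * (t ^ k * (\<Prod>i\<in>I. y i / (t * z i)))"
  proof -
    have "(\<Prod>i\<in>I. z i) > 0" by (intro prod_pos) (use I z0 in auto)
    then show ?thesis using t by (simp add: prod_dividef prod.distrib k_def)
  qed
  also have "\<dots> \<le> (\<Prod>i\<in>I. z i) * (t ^ k * (\<Prod>i<k. a i / t))"
    by (intro mult_left_mono * prod_nonneg) (use I z0 t in \<open>auto intro: less_imp_le\<close>)
  also have "t ^ k * (\<Prod>i<k. a i / t) = (\<Prod>i<k. a i)"
    using t by (simp add: prod_dividef)
  finally show ?thesis by (simp add: x_def z_def a_def k_def)
qed simp

section \<open>Log-majorization for products of positive definite matrices\<close>

text \<open>Moving the last factor cyclically to the front replaces a product that need not be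
  symmetric by a congruence of \<open>A\<close>, which is symmetric whenever \<open>A\<close>
  is.\<close>

lemma eigs_mult_congruence:
  fixes A R :: "real mat"
  assumes A: "A \<in> carrier_mat n n" and R: "R \<in> carrier_mat n n"
  shows "eigs (A * (R * transpose_mat R)) = eigs (transpose_mat R * A * R)"
proof -
  have "char_poly (A * (R * transpose_mat R)) = char_poly ((A * R) * transpose_mat R)"
    using A R by (simp add: assoc_mult_mat[of _ n n _ n _ n])
  also have "\<dots> = char_poly (transpose_mat R * (A * R))"
    by (rule char_poly_mult_comm_square[of _ n]) (use A R in auto)
  also have "\<dots> = char_poly (transpose_mat R * A * R)"
    using A R by (simp add: assoc_mult_mat[of _ n n _ n _ n])
  finally show ?thesis by (simp add: eigs_def)
qed

lemma eigs_mult_commute: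
  assumes "A \<in> carrier_mat n n" "B \<in> carrier_mat n n"
  shows "eigs (A * B) = eigs (B * A)"
  using char_poly_mult_comm_square[OF assms] by (simp add: eigs_def)

lemma transpose_mat_diag: "transpose_mat (mat_diag n d) = mat_diag n d"
  by (rule eq_matI) (auto simp: mat_diag_def)

lemma mult_diag_transpose:
  fixes U :: "real mat"
  assumes "U \<in> carrier_mat n n"
  shows "(U * mat_diag n d) * transpose_mat (U * mat_diag n d) = U * mat_diag n (\<lambda>i. d i * d i) * transpose_mat U"
proof -
  have "(U * mat_diag n d) * transpose_mat (U * mat_diag n d) = U * (mat_diag n d * mat_diag n d) * transpose_mat U"
    using assms by (simp del: mat_diag_diag add: mult_carrier_mat[of _ n n _ n] assoc_mult_mat[of _ n n _ n _ n] transpose_mult[of _ n n _ n] transpose_mat_diag)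
  then show ?thesis by simp
qed

lemma mat_diag_cong: "(\<And>i. i < n \<Longrightarrow> d i = e i) \<Longrightarrow> mat_diag n d = mat_diag n e"
  by (rule eq_matI) (auto simp: mat_diag_def)

lemma pos_semidef_factor:
  assumes B: "pos_semidef n B"
  obtains R where "R \<in> carrier_mat n n" "B = R * transpose_mat R"
proof -
  obtain W where W: "W \<in> carrier_mat n n" "B = W * mat_diag n (\<lambda>i. eigs B ! i) * transpose_mat W"
    by (rule symmetric_spectral[OF pos_semidefD(1,2)[OF B]])
  let ?R = "W * mat_diag n (\<lambda>i. sqrt (eigs B ! i))"
  have "mat_diag n (\<lambda>i. sqrt (eigs B ! i) * sqrt (eigs B ! i)) = mat_diag n (\<lambda>i. eigs B ! i)"
    using eigs_nonneg[OF B] by (intro mat_diag_cong) simp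
  then have "?R * transpose_mat ?R = B"
    using W mult_diag_transpose[OF W(1)] by simp
  moreover have "?R \<in> carrier_mat n n" using W(1) by (intro mult_carrier_mat[of _ n n]) auto
  ultimately show thesis using that by metis
qed

text \<open>With B = W D W^T, take R = W D^(1/2) and S = D^(-1/2) W^T. Then S^T S is the inverse of
  \<open>B\<close>; its eigenvalues are the reciprocals, and sorting them reverses the order. This
  is where the opposite pairing of indices in the lower bound comes from.\<close>

lemma pos_def_factor:
  assumes B: "pos_def n B"
  obtains R S where "R \<in> carrier_mat n n" "S \<in> carrier_mat n n" "B = R * transpose_mat R"
    "S * R = 1\<^sub>m n" "R * S = 1\<^sub>m n"
    "\<forall>i<n. eigs (transpose_mat S * S) ! i = 1 / eigs B ! (n - 1 - i)"
proof -
  note Bc = pos_defD(1,2)[OF B]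
  obtain W where W: "W \<in> carrier_mat n n" "transpose_mat W * W = 1\<^sub>m n" "W * transpose_mat W = 1\<^sub>m n"
    "B = W * mat_diag n (\<lambda>i. eigs B ! i) * transpose_mat W"
    by (rule symmetric_spectral[OF Bc])
  have pos: "0 < eigs B ! i" if "i < n" for i using eigs_pos[OF B that] .
  let ?r = "\<lambda>i. sqrt (eigs B ! i)" and ?s = "\<lambda>i. 1 / sqrt (eigs B ! i)"
  let ?R = "W * mat_diag n ?r" and ?T = "W * mat_diag n ?s"
  let ?S = "transpose_mat ?T"
  have R: "?R \<in> carrier_mat n n" and T: "?T \<in> carrier_mat n n"
    using W(1) by (intro mult_carrier_mat[of _ n n], auto)+
  have "mat_diag n (\<lambda>i. ?r i * ?r i) = mat_diag n (\<lambda>i. eigs B ! i)"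
    using pos by (intro mat_diag_cong) (simp add: less_imp_le)
  then have BR: "B = ?R * transpose_mat ?R"
    using W mult_diag_transpose[OF W(1)] by simp
  have "?S * ?R = mat_diag n ?s * (transpose_mat W * W) * mat_diag n ?r"
    using W(1) by (simp del: mat_diag_diag add: mult_carrier_mat[of _ n n _ n] assoc_mult_mat[of _ n n _ n _ n]
        transpose_mult[of _ n n _ n] transpose_mat_diag)
  also have "\<dots> = mat_diag n (\<lambda>i. ?s i * ?r i)"
    unfolding W(2) right_mult_one_mat[OF mat_diag_dim] by (rule mat_diag_diag)
  also have "\<dots> = mat_diag n (\<lambda>_. 1)" using pos by (intro mat_diag_cong) (simp add: less_imp_neq[OF pos, symmetric])
  finally have SR: "?S * ?R = 1\<^sub>m n" by simp
  then have RS: "?R * ?S = 1\<^sub>m n"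
    using mat_mult_left_right_inverse[of ?S n ?R] R T by simp
  have e: "eigs (transpose_mat ?S * ?S) ! i = 1 / eigs B ! (n - 1 - i)" if i: "i < n" for i
  proof -
    have "mat_diag n (\<lambda>i. ?s i * ?s i) = mat_diag n (\<lambda>i. 1 / eigs B ! i)"
      using pos by (intro mat_diag_cong) (simp add: less_imp_le)
    then have SS: "transpose_mat ?S * ?S = W * mat_diag n (\<lambda>i. 1 / eigs B ! i) * transpose_mat W"
      using mult_diag_transpose[OF W(1), of ?s] by simp
    have "rev (map (\<lambda>i. 1 / eigs B ! i) [0..<n]) = map (\<lambda>i. 1 / eigs B ! (n - 1 - i)) [0..<n]"
      by (rule nth_equalityI) (auto simp: rev_nth)
    then have "mset (map (\<lambda>i. 1 / eigs B ! i) [0..<n]) = mset (map (\<lambda>i. 1 / eigs B ! (n - 1 - i)) [0..<n])"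
      by (metis mset_rev)
    then have "eigs (transpose_mat ?S * ?S) = rev (sorted_list_of_multiset (mset (map (\<lambda>i. 1 / eigs B ! (n - 1 - i)) [0..<n])))"
      unfolding SS using W by (subst eigs_def, subst proots_char_poly_diagonalized) auto
    also have "\<dots> = map (\<lambda>i. 1 / eigs B ! (n - 1 - i)) [0..<n]"
    proof (rule rev_sorted_list_of_mset_eqI)
      fix i j assume "i \<le> j" "j < n"
      then show "1 / eigs B ! (n - 1 - j) \<le> 1 / eigs B ! (n - 1 - i)"
        using pos[of "n - 1 - j"] eigs_antimono[OF Bc, of "n - 1 - j" "n - 1 - i"]
        by (intro divide_left_mono mult_pos_pos pos) auto
    qed
    finally show ?thesis using i by simp
  qed
  show thesis by (rule that[OF R _ BR SR RS]) (use T e in simp_all)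
qed

lemma eigs_one: "i < n \<Longrightarrow> eigs (1\<^sub>m n) ! i = 1"
  using eigs_diagonalized[of "1\<^sub>m n" n "1\<^sub>m n" "\<lambda>_. 1"] by simp

text \<open>The congruence inequality for R = 1: the identity contributes only factors 1.\<close>

lemma prod_eigs_le_leading:
  assumes A: "pos_def n A" and I: "I \<subseteq> {..<n}"
  shows "(\<Prod>i\<in>I. eigs A ! i) \<le> (\<Prod>j<card I. eigs A ! j)"
proof -
  have "(\<Prod>i\<in>I. eigs (1\<^sub>m n) ! i) = 1"
    using I by (intro prod.neutral) (auto simp: eigs_one)
  then show ?thesis
    using prod_eigs_congruence_le[OF A one_carrier_mat one_carrier_mat _ I] pos_defD(1)[OF A] by simp
qed

text \<open>\<open>R\<close> times its transpose and the transpose times \<open>R\<close> have the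
  same eigenvalues, so the congruence inequality gives the eigenvalues of \<open>B\<close> over
  \<open>I\<close>; these are then bounded by the leading ones, the form in which majorization is
  used.\<close>

lemma prod_eigs_mult_le:
  assumes A: "pos_def n A" and B: "pos_def n B" and I: "I \<subseteq> {..<n}"
  shows "(\<Prod>i\<in>I. eigs (A * B) ! i) \<le> (\<Prod>j<card I. eigs A ! j * eigs B ! j)"
proof -
  obtain R S where R: "R \<in> carrier_mat n n" and S: "S \<in> carrier_mat n n" "S * R = 1\<^sub>m n"
    and BR: "B = R * transpose_mat R"
    using pos_def_factor[OF B] by metis
  have "eigs (transpose_mat R * R) = eigs B"
    unfolding BR using eigs_mult_commute[of R n "transpose_mat R"] R by simp
  then have "(\<Prod>i\<in>I. eigs (A * B) ! i) \<le> (\<Prod>i\<in>I. eigs B ! i) * (\<Prod>j<card I. eigs A ! j)"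
    using prod_eigs_congruence_le[OF A R S I] eigs_mult_congruence[OF pos_defD(1)[OF A] R] BR by simp
  also have "\<dots> \<le> (\<Prod>j<card I. eigs B ! j) * (\<Prod>j<card I. eigs A ! j)"
  proof (intro mult_right_mono prod_eigs_le_leading[OF B I] prod_nonneg)
    fix j assume "j \<in> {..<card I}"
    then show "0 \<le> eigs A ! j"
      using card_mono[OF _ I] by (intro less_imp_le eigs_pos[OF A]) auto
  qed
  finally show ?thesis by (simp add: prod.distrib mult.commute)
qed

text \<open>Congruence by \<open>S\<close> undoes congruence by \<open>R\<close>, so now
  \<open>A\<close> is the transformed matrix and \<open>?M\<close>, with the eigenvalues of
  \<open>A * B\<close>, is the one bounded by its leading eigenvalues. The factors from
  \<open>transpose_mat S * S\<close> are reciprocals of eigenvalues of \<open>B\<close> and move to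
  the left-hand side.\<close>

lemma prod_eigs_mult_ge:
  assumes A: "pos_def n A" and B: "pos_def n B" and I: "I \<subseteq> {..<n}"
  shows "(\<Prod>i\<in>I. eigs A ! i * eigs B ! (n - 1 - i)) \<le> (\<Prod>j<card I. eigs (A * B) ! j)"
proof -
  note Ac = pos_defD(1,2)[OF A]
  obtain R S where R: "R \<in> carrier_mat n n" and S: "S \<in> carrier_mat n n" and BR: "B = R * transpose_mat R"
    and inv: "S * R = 1\<^sub>m n" "R * S = 1\<^sub>m n"
    and e: "\<forall>i<n. eigs (transpose_mat S * S) ! i = 1 / eigs B ! (n - 1 - i)"
    using pos_def_factor[OF B] by metis
  let ?M = "transpose_mat R * A * R"
  have M: "pos_def n ?M" by (rule pos_def_congruence[OF A R S inv(1)])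
  have "transpose_mat S * ?M * S = transpose_mat (R * S) * A * (R * S)"
    using R S Ac(1) by (simp add: transpose_mult[of _ n n _ n] assoc_mult_mat[of _ n n _ n _ n])
  then have SMS: "transpose_mat S * ?M * S = A" using inv(2) Ac(1) by simp
  have pos: "0 < eigs B ! (n - 1 - i)" if "i \<in> I" for i
    by (rule eigs_pos[OF B]) (use I that in auto)
  have "(\<Prod>i\<in>I. eigs A ! i) \<le> (\<Prod>i\<in>I. eigs (transpose_mat S * S) ! i) * (\<Prod>j<card I. eigs (A * B) ! j)"
    using prod_eigs_congruence_le[OF M S R inv(2) I] eigs_mult_congruence[OF Ac(1) R] BR SMS by simp
  also have "(\<Prod>i\<in>I. eigs (transpose_mat S * S) ! i) = (\<Prod>i\<in>I. 1 / eigs B ! (n - 1 - i))"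
    using I e by (intro prod.cong) auto
  also have "\<dots> = 1 / (\<Prod>i\<in>I. eigs B ! (n - 1 - i))" by (simp add: prod_dividef)
  finally show ?thesis
    using prod_pos[of I "\<lambda>i. eigs B ! (n - 1 - i)"] pos by (simp add: prod.distrib field_simps)
qed

lemma eigs_mult_pos:
  assumes A: "pos_def n A" and B: "pos_def n B" and i: "i < n"
  shows "0 < eigs (A * B) ! i"
proof -
  obtain R S where R: "R \<in> carrier_mat n n" and S: "S \<in> carrier_mat n n" "S * R = 1\<^sub>m n"
    and BR: "B = R * transpose_mat R"
    using pos_def_factor[OF B] by metis
  show ?thesis
    unfolding BR eigs_mult_congruence[OF pos_defD(1)[OF A] R]
    by (rule eigs_pos[OF pos_def_congruence[OF A R S] i])
qed

section \<open>Karamata's inequality and log-majorization\<close>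

text \<open>Summation by parts as an induction: since the partial sums of \<open>d\<close> are
  nonnegative, the weight in front of them may be lowered from \<open>w k\<close> to
  \<open>w (Suc k)\<close> at each step. The last weight may have any sign, but it multiplies the
  total, which is 0.\<close>

lemma sum_mult_antimono_nonneg:
  fixes w d :: "nat \<Rightarrow> real"
  assumes w: "\<And>i j. i \<le> j \<Longrightarrow> j < n \<Longrightarrow> w j \<le> w i"
    and d: "\<And>k. k \<le> n \<Longrightarrow> 0 \<le> (\<Sum>j<k. d j)" and dn: "(\<Sum>j<n. d j) = 0"
  shows "0 \<le> (\<Sum>i<n. w i * d i)"
proof -
  have partial: "w k * (\<Sum>j<Suc k. d j) \<le> (\<Sum>i<Suc k. w i * d i)" if "Suc k \<le> n" for k
    using that
  proof (induction k)
    case (Suc k)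
    have "w (Suc k) * (\<Sum>j<Suc k. d j) \<le> w k * (\<Sum>j<Suc k. d j)"
      using Suc.prems by (intro mult_right_mono w d) auto
    also have "\<dots> \<le> (\<Sum>i<Suc k. w i * d i)" using Suc by simp
    finally show ?case by (simp add: distrib_left)
  qed simp
  show ?thesis
  proof (cases n)
    case (Suc k)
    then show ?thesis using partial[of k] dn by simp
  qed simp
qed

text \<open>The tangents are taken at the points x, rearranged in descending order as
  \<open>z\<close>, which makes the slopes antitone; summation by parts with the differences y - z
  then gives the claim. As \<open>x\<close> comes unsorted, \<open>le\<close> ranges over all index
  sets, so that it applies to the positions of the k largest entries.\<close>

lemma karamata:
  fixes g g' :: "real \<Rightarrow> real" and x y :: "nat \<Rightarrow> real"
  assumes tangent: "\<And>s t. g s + g' s * (t - s) \<le> g t" and mono: "mono g'"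
    and le: "\<And>I. I \<subseteq> {..<n} \<Longrightarrow> (\<Sum>i\<in>I. x i) \<le> (\<Sum>j<card I. y j)"
    and total: "(\<Sum>i<n. y i) \<le> (\<Sum>i<n. x i)"
  shows "(\<Sum>i<n. g (x i)) \<le> (\<Sum>i<n. g (y i))"
proof -
  have "mset (rev (sort (map x [0..<n]))) = mset (map x [0..<n])" by simp
  then obtain p where "p permutes {..<length (map x [0..<n])}"
    and perm: "permute_list p (map x [0..<n]) = rev (sort (map x [0..<n]))"
    by (rule mset_eq_permutation)
  then have p: "p permutes {..<n}" by simp
  have pn: "p i < n" if "i < n" for i
    using that permutes_in_image[OF p] by auto
  define z where "z i = x (p i)" for i
  have z: "z i = rev (sort (map x [0..<n])) ! i" if "i < n" for i
    using that p pn by (simp flip: perm add: permute_list_nth z_def)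
  have zmono: "z j \<le> z i" if "i \<le> j" "j < n" for i j
    using that unfolding z[OF \<open>j < n\<close>] z[OF le_less_trans[OF \<open>i \<le> j\<close> \<open>j < n\<close>]]
    by (intro sorted_rev_nth_mono) auto
  have zy: "0 \<le> (\<Sum>j<k. y j - z j)" if "k \<le> n" for k
  proof -
    have inj: "inj_on p {..<k}" using permutes_inj[OF p] by (rule inj_on_subset) simp
    have "(\<Sum>i\<in>p ` {..<k}. x i) \<le> (\<Sum>j<card (p ` {..<k}). y j)"
      by (rule le) (use pn that in auto)
    then show ?thesis
      by (simp add: sum.reindex[OF inj] card_image[OF inj] z_def sum_subtractf)
  qed
  have perm_sum: "(\<Sum>i<n. h (z i)) = (\<Sum>i<n. h (x i))" for h :: "real \<Rightarrow> real"
    unfolding z_def using sum.permute[OF p, of "\<lambda>i. h (x i)"] by simp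
  \<comment> \<open>\<open>le\<close> for the full index set and \<open>total\<close> together force
    equal sums.\<close>
  have "(\<Sum>j<n. y j - z j) = 0"
    using zy[of n] total perm_sum[of "\<lambda>s. s"] by (simp add: sum_subtractf)
  then have "0 \<le> (\<Sum>i<n. g' (z i) * (y i - z i))"
    by (intro sum_mult_antimono_nonneg zy) (auto intro: monoD[OF mono] zmono)
  also have "\<dots> \<le> (\<Sum>i<n. g (y i) - g (z i))"
    by (intro sum_mono) (use tangent in \<open>simp add: algebra_simps\<close>)
  finally show ?thesis using perm_sum[of g] by (simp add: sum_subtractf)
qed

text \<open>Karamata for g(s) = f(e^s), whose derivative is monotone by \<open>mono\<close>; the
  mean value theorem turns this into the tangent inequality. The numbers \<open>c\<close> and
  \<open>d\<close> stand for squared singular values, hence the square roots, which merely halve the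
  logarithms.\<close>

lemma log_majorization_sum_le:
  fixes f f' :: "real \<Rightarrow> real" and c d :: "nat \<Rightarrow> real"
  assumes deriv: "\<And>s. 0 < s \<Longrightarrow> (f has_real_derivative f' s) (at s)"
    and mono: "mono_on {0<..} (\<lambda>s. s * f' s)"
    and c: "\<And>i. i < n \<Longrightarrow> 0 < c i" and d: "\<And>i. i < n \<Longrightarrow> 0 < d i"
    and le: "\<And>I. I \<subseteq> {..<n} \<Longrightarrow> (\<Prod>i\<in>I. c i) \<le> (\<Prod>j<card I. d j)"
    and total: "(\<Prod>i<n. d i) \<le> (\<Prod>i<n. c i)"
  shows "(\<Sum>i<n. f (sqrt (c i))) \<le> (\<Sum>i<n. f (sqrt (d i)))"
proof -
  define g where "g s = f (exp s)" for s
  define g' where "g' s = exp s * f' (exp s)" for s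
  have g: "(g has_real_derivative g' s) (at s)" for s
    unfolding g_def g'_def
    using DERIV_chain2[OF deriv[OF exp_gt_zero] DERIV_exp[of s]] by (simp add: mult.commute)
  have g'_mono: "mono g'"
    unfolding g'_def by (intro monoI mono_onD[OF mono]) auto
  have tangent: "g s + g' s * (t - s) \<le> g t" for s t
  proof -
    consider "s < t" | "s = t" | "t < s" by linarith
    then show ?thesis
    proof cases
      case 1
      then obtain u where "s < u" "u < t" "g t - g s = (t - s) * g' u"
        using MVT2[of s t g g'] g by auto
      moreover have "(t - s) * g' s \<le> (t - s) * g' u"
        using 1 \<open>s < u\<close> by (intro mult_left_mono monoD[OF g'_mono]) auto
      ultimately have "(t - s) * g' s \<le> g t - g s" by simp
      then show ?thesis by (simp add: algebra_simps)
    next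
      case 3
      then obtain u where "t < u" "u < s" "g s - g t = (s - t) * g' u"
        using MVT2[of t s g g'] g by auto
      moreover have "(s - t) * g' u \<le> (s - t) * g' s"
        using 3 \<open>u < s\<close> by (intro mult_left_mono monoD[OF g'_mono]) auto
      ultimately have "g s - g t \<le> (s - t) * g' s" by simp
      then show ?thesis by (simp add: algebra_simps)
    qed simp
  qed
  have ln_sum: "(\<Sum>i\<in>I. ln (sqrt (h i))) = ln (\<Prod>i\<in>I. h i) / 2"
    if "I \<subseteq> {..<n}" "\<And>i. i < n \<Longrightarrow> 0 < h i" for I and h :: "nat \<Rightarrow> real"
  proof -
    have pos: "\<And>i. i \<in> I \<Longrightarrow> 0 < h i" using that by auto
    have "finite I" using that(1) finite_subset by blast
    then have "ln (\<Prod>i\<in>I. h i) = (\<Sum>i\<in>I. ln (h i))"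
      by (rule ln_prod) (use pos in force)
    moreover have "(\<Sum>i\<in>I. ln (sqrt (h i))) = (\<Sum>i\<in>I. ln (h i) / 2)"
      by (intro sum.cong refl) (simp add: ln_sqrt less_imp_le[OF pos])
    ultimately show ?thesis by (simp add: sum_divide_distrib)
  qed
  have "(\<Sum>i<n. g (ln (sqrt (c i)))) \<le> (\<Sum>i<n. g (ln (sqrt (d i))))"
  proof (rule karamata[OF tangent g'_mono])
    fix I assume I: "I \<subseteq> {..<n}"
    then have "card I \<le> n" using card_mono[of "{..<n}" I] by simp
    then have sub: "{..<card I} \<subseteq> {..<n}" by auto
    have "0 < (\<Prod>i\<in>I. c i)"
      using I c by (auto intro!: prod_pos)
    with le[OF I] have "ln (\<Prod>i\<in>I. c i) \<le> ln (\<Prod>j<card I. d j)"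
      by (subst ln_le_cancel_iff) auto
    then show "(\<Sum>i\<in>I. ln (sqrt (c i))) \<le> (\<Sum>j<card I. ln (sqrt (d j)))"
      using ln_sum[of I c, OF I c] ln_sum[of "{..<card I}" d, OF sub d] by simp
  next
    have "0 < (\<Prod>i<n. d i)"
      using d by (auto intro!: prod_pos)
    with total have "ln (\<Prod>i<n. d i) \<le> ln (\<Prod>i<n. c i)"
      by (subst ln_le_cancel_iff) auto
    then show "(\<Sum>i<n. ln (sqrt (d i))) \<le> (\<Sum>i<n. ln (sqrt (c i)))"
      using ln_sum[of "{..<n}" c, OF _ c] ln_sum[of "{..<n}" d, OF _ d] by simp
  qed
  then show ?thesis using c d by (simp add: g_def)
qed

lemma sum_eigs_mult_pos_def:
  fixes f f' :: "real \<Rightarrow> real"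
  assumes deriv: "\<And>s. 0 < s \<Longrightarrow> (f has_real_derivative f' s) (at s)"
    and mono: "mono_on {0<..} (\<lambda>s. s * f' s)"
    and A: "pos_def n A" and B: "pos_def n B"
  shows "(\<Sum>i<n. f (sqrt (eigs A ! i * eigs B ! (n - 1 - i)))) \<le> (\<Sum>i<n. f (sqrt (eigs (A * B) ! i)))"
    and "(\<Sum>i<n. f (sqrt (eigs (A * B) ! i))) \<le> (\<Sum>i<n. f (sqrt (eigs A ! i * eigs B ! i)))"
proof -
  have pos: "0 < eigs A ! i * eigs B ! j" if "i < n" "j < n" for i j
    using eigs_pos[OF A that(1)] eigs_pos[OF B that(2)] by simp
  \<comment> \<open>Over all indices the two pairings have the same product. Hence the upper product
    bound for the full index set supplies the equality of totals that the lower sum bound needs, and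
    conversely.\<close>
  have E: "(\<Prod>i<n. eigs A ! i * eigs B ! i) = (\<Prod>i<n. eigs A ! i * eigs B ! (n - 1 - i))"
    unfolding prod.distrib using prod.nat_diff_reindex[of "(!) (eigs B)" n] by simp
  have "(\<Prod>i<n. eigs A ! i * eigs B ! i) \<le> (\<Prod>i<n. eigs (A * B) ! i)"
    unfolding E using prod_eigs_mult_ge[OF A B subset_refl] by simp
  moreover have "(\<Prod>i<n. eigs (A * B) ! i) \<le> (\<Prod>i<n. eigs A ! i * eigs B ! (n - 1 - i))"
    unfolding E[symmetric] using prod_eigs_mult_le[OF A B subset_refl] by simp
  ultimately show "(\<Sum>i<n. f (sqrt (eigs A ! i * eigs B ! (n - 1 - i)))) \<le> (\<Sum>i<n. f (sqrt (eigs (A * B) ! i)))"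
    "(\<Sum>i<n. f (sqrt (eigs (A * B) ! i))) \<le> (\<Sum>i<n. f (sqrt (eigs A ! i * eigs B ! i)))"
    using prod_eigs_mult_ge[OF A B] prod_eigs_mult_le[OF A B]
    by (auto intro!: log_majorization_sum_le[OF deriv mono] pos eigs_mult_pos[OF A B])
qed

section \<open>Positive semidefinite matrices by perturbation\<close>

lemma quadratic_form_le_top_eig:
  assumes A: "A \<in> carrier_mat n n" "transpose_mat A = A" and v: "v \<in> carrier_vec n"
  shows "v \<bullet> (A *\<^sub>v v) \<le> eigs A ! 0 * (v \<bullet> v)"
proof -
  obtain U where U: "U \<in> carrier_mat n n" "U * transpose_mat U = 1\<^sub>m n"
    "A = U * mat_diag n (\<lambda>i. eigs A ! i) * transpose_mat U"
    by (rule symmetric_spectral[OF A])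
  have "v \<bullet> (A *\<^sub>v v) = (\<Sum>i<n. eigs A ! i * ((transpose_mat U *\<^sub>v v) $ i)\<^sup>2)"
    by (subst U(3)) (rule quadratic_form_diagonalized[OF U(1) v])
  also have "\<dots> \<le> (\<Sum>i<n. eigs A ! 0 * ((transpose_mat U *\<^sub>v v) $ i)\<^sup>2)"
    by (intro sum_mono mult_right_mono eigs_antimono[OF A]) auto
  also have "\<dots> = eigs A ! 0 * (v \<bullet> v)"
    unfolding norm_square_orthogonal[OF U(1,2) v] by (simp add: sum_distrib_left)
  finally show ?thesis .
qed

lemma quadratic_form_add_one_smult:
  assumes "A \<in> carrier_mat n n" "v \<in> carrier_vec n"
  shows "v \<bullet> ((A + t \<cdot>\<^sub>m 1\<^sub>m n) *\<^sub>v v) = v \<bullet> (A *\<^sub>v v) + (t :: real) * (v \<bullet> v)"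
proof -
  have "(A + t \<cdot>\<^sub>m 1\<^sub>m n) *\<^sub>v v = A *\<^sub>v v + (t \<cdot>\<^sub>m 1\<^sub>m n) *\<^sub>v v"
    using assms by (intro add_mult_distrib_mat_vec) auto
  also have "(t \<cdot>\<^sub>m 1\<^sub>m n) *\<^sub>v v = t \<cdot>\<^sub>v v"
    using assms(2) by (simp add: smult_mat_mult_vec[of _ n n])
  finally show ?thesis
    using assms by (simp add: scalar_prod_add_distrib[of _ n])
qed

lemma symmetric_add_one_smult:
  assumes "A \<in> carrier_mat n n" "transpose_mat A = A"
  shows "A + t \<cdot>\<^sub>m 1\<^sub>m n \<in> carrier_mat n n"
    "transpose_mat (A + t \<cdot>\<^sub>m 1\<^sub>m n) = A + (t :: real) \<cdot>\<^sub>m 1\<^sub>m n"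
  using assms by (auto simp: transpose_add[of _ n n] transpose_smult_mat)

lemma pos_def_add_one_smult:
  assumes A: "pos_semidef n A" and t: "0 < t"
  shows "pos_def n (A + t \<cdot>\<^sub>m 1\<^sub>m n)"
  unfolding pos_def_def
proof (intro conjI ballI impI)
  fix v :: "real vec" assume v: "v \<in> carrier_vec n" "v \<noteq> 0\<^sub>v n"
  have "0 < t * (v \<bullet> v)" using scalar_prod_self_pos[OF v] t by simp
  then show "0 < v \<bullet> ((A + t \<cdot>\<^sub>m 1\<^sub>m n) *\<^sub>v v)"
    using quadratic_form_add_one_smult[OF pos_semidefD(1)[OF A] v(1)] pos_semidefD(3)[OF A v(1)] by simp
qed (use symmetric_add_one_smult[OF pos_semidefD(1,2)[OF A]] in auto)

text \<open>For B = R R^T the shift of \<open>A\<close> by t adds t R^T R to R^T A R. As a quadratic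
  form this lies between 0 and t times the top eigenvalue of \<open>B\<close>, and monotonicity of
  eigenvalues gives both bounds.\<close>

lemma eigs_mult_add_one_smult:
  assumes A: "pos_semidef n A" and B: "pos_semidef n B" and t: "0 \<le> t" and i: "i < n"
  shows "eigs (A * B) ! i \<le> eigs ((A + t \<cdot>\<^sub>m 1\<^sub>m n) * B) ! i"
    and "eigs ((A + t \<cdot>\<^sub>m 1\<^sub>m n) * B) ! i \<le> eigs (A * B) ! i + t * eigs B ! 0"
proof -
  note Ac = pos_semidefD(1,2)[OF A]
  let ?A = "A + t \<cdot>\<^sub>m 1\<^sub>m n"
  note At = symmetric_add_one_smult[OF Ac, of t]
  obtain R where R: "R \<in> carrier_mat n n" "B = R * transpose_mat R"
    using pos_semidef_factor[OF B] by metis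
  let ?M = "transpose_mat R * A * R" and ?N = "transpose_mat R * ?A * R"
  have M: "?M \<in> carrier_mat n n" "transpose_mat ?M = ?M"
    using R Ac transpose_congruence[OF Ac R(1)] by auto
  have N: "?N \<in> carrier_mat n n" "transpose_mat ?N = ?N"
    using R At transpose_congruence[OF At R(1)] by auto
  note Mt = symmetric_add_one_smult[OF M, of "t * eigs B ! 0"]
  have eigs_eq: "eigs (A * B) = eigs ?M" "eigs (?A * B) = eigs ?N"
    using eigs_mult_congruence[OF Ac(1) R(1)] eigs_mult_congruence[OF At(1) R(1)] R(2) by simp_all
  have RR: "transpose_mat R * R \<in> carrier_mat n n" "transpose_mat (transpose_mat R * R) = transpose_mat R * R"
    using R(1) by (auto simp: transpose_mult[of _ n n _ n])
  have eRR: "eigs (transpose_mat R * R) = eigs B"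
    unfolding R(2) using eigs_mult_commute[of R n "transpose_mat R"] R by simp
  have N_form: "v \<bullet> (?N *\<^sub>v v) = v \<bullet> (?M *\<^sub>v v) + t * (v \<bullet> ((transpose_mat R * R) *\<^sub>v v))"
    if v: "v \<in> carrier_vec n" for v
  proof -
    have Rv: "R *\<^sub>v v \<in> carrier_vec n" using R v by simp
    have "v \<bullet> ((transpose_mat R * R) *\<^sub>v v) = (R *\<^sub>v v) \<bullet> (R *\<^sub>v v)"
      using quadratic_form_congruence[OF one_carrier_mat R(1) v] R(1) Rv by simp
    then show ?thesis
      using quadratic_form_congruence[OF Ac(1) R(1) v] quadratic_form_congruence[OF At(1) R(1) v]
        quadratic_form_add_one_smult[OF Ac(1) Rv] by simp
  qed
  have RR0: "0 \<le> v \<bullet> ((transpose_mat R * R) *\<^sub>v v)" if v: "v \<in> carrier_vec n" for v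
    using pos_semidef_congruence[OF pos_def_imp_pos_semidef[OF pos_def_one] R(1)] v R(1)
    by (simp add: pos_semidef_def)
  show "eigs (A * B) ! i \<le> eigs (?A * B) ! i"
    unfolding eigs_eq by (rule eigs_mono[OF M N _ i]) (use N_form RR0 t in simp)
  have "eigs ?N ! i \<le> eigs (?M + (t * eigs B ! 0) \<cdot>\<^sub>m 1\<^sub>m n) ! i"
  proof (rule eigs_mono[OF N Mt _ i])
    fix v :: "real vec" assume v: "v \<in> carrier_vec n"
    have "t * (v \<bullet> ((transpose_mat R * R) *\<^sub>v v)) \<le> t * (eigs B ! 0 * (v \<bullet> v))"
      using quadratic_form_le_top_eig[OF RR v] t unfolding eRR by (intro mult_left_mono)
    then show "v \<bullet> (?N *\<^sub>v v) \<le> v \<bullet> ((?M + (t * eigs B ! 0) \<cdot>\<^sub>m 1\<^sub>m n) *\<^sub>v v)"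
      unfolding N_form[OF v] quadratic_form_add_one_smult[OF M(1) v] by (simp add: mult.assoc)
  qed
  then show "eigs (?A * B) ! i \<le> eigs (A * B) ! i + t * eigs B ! 0"
    unfolding eigs_eq eigs_add_one_smult[OF M i] .
qed

text \<open>One factor is shifted at a time: \<open>A\<close> against \<open>B\<close>, then
  \<open>B\<close> against the shifted \<open>A\<close>, with the factors exchanged by
  \<open>eigs_mult_commute\<close>. The second error involves the top eigenvalue of the shifted
  \<open>A\<close>, hence the term \<open>t * (eigs A ! 0 + t)\<close>.\<close>

lemma tendsto_eigs_mult_add_one_smult:
  assumes A: "pos_semidef n A" and B: "pos_semidef n B" and i: "i < n"
  shows "((\<lambda>t. eigs ((A + t \<cdot>\<^sub>m 1\<^sub>m n) * (B + t \<cdot>\<^sub>m 1\<^sub>m n)) ! i) \<longlongrightarrow> eigs (A * B) ! i) (at_right 0)"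
proof (rule tendsto_sandwich)
  let ?A = "\<lambda>t. A + t \<cdot>\<^sub>m 1\<^sub>m n" and ?B = "\<lambda>t. B + t \<cdot>\<^sub>m 1\<^sub>m n"
  have bounds: "eigs (A * B) ! i \<le> eigs (?A t * ?B t) ! i \<and>
      eigs (?A t * ?B t) ! i \<le> eigs (A * B) ! i + t * eigs B ! 0 + t * (eigs A ! 0 + t)"
    if "0 < t" for t
  proof -
    have t: "0 \<le> t" using that by simp
    have At: "pos_semidef n (?A t)"
      by (rule pos_def_imp_pos_semidef[OF pos_def_add_one_smult[OF A that]])
    have Bc: "B \<in> carrier_mat n n" "?B t \<in> carrier_mat n n" "?A t \<in> carrier_mat n n"
      using pos_semidefD(1)[OF A] pos_semidefD(1)[OF B] by auto
    have comm: "eigs (?B t * ?A t) = eigs (?A t * ?B t)" "eigs (B * ?A t) = eigs (?A t * B)"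
      using Bc by (auto intro: eigs_mult_commute[of _ n])
    have "eigs (?A t) ! 0 = eigs A ! 0 + t"
      using i by (intro eigs_add_one_smult pos_semidefD(1,2)[OF A]) auto
    then show ?thesis
      using eigs_mult_add_one_smult[OF A B t i] eigs_mult_add_one_smult[OF B At t i]
      unfolding comm by simp
  qed
  show "\<forall>\<^sub>F t in at_right 0. eigs (A * B) ! i \<le> eigs (?A t * ?B t) ! i"
    using eventually_at_right_less[of 0] by (rule eventually_mono) (use bounds in blast)
  show "\<forall>\<^sub>F t in at_right 0. eigs (?A t * ?B t) ! i \<le> eigs (A * B) ! i + t * eigs B ! 0 + t * (eigs A ! 0 + t)"
    using eventually_at_right_less[of 0] by (rule eventually_mono) (use bounds in blast)
  show "((\<lambda>t. eigs (A * B) ! i + t * eigs B ! 0 + t * (eigs A ! 0 + t)) \<longlongrightarrow> eigs (A * B) ! i) (at_right 0)"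
    by (auto intro!: tendsto_eq_intros)
qed simp

lemma eigs_mult_nonneg:
  assumes A: "pos_semidef n A" and B: "pos_semidef n B" and i: "i < n"
  shows "0 \<le> eigs (A * B) ! i"
proof -
  obtain R where R: "R \<in> carrier_mat n n" "B = R * transpose_mat R"
    using pos_semidef_factor[OF B] by metis
  show ?thesis
    unfolding R(2) eigs_mult_congruence[OF pos_semidefD(1)[OF A] R(1)]
    by (rule eigs_nonneg[OF pos_semidef_congruence[OF A R(1)] i])
qed

text \<open>In other words, all eigenvalues of the product are real, because they are those of a
  symmetric congruence.\<close>

lemma length_eigs_mult:
  assumes A: "pos_semidef n A" and B: "pos_semidef n B"
  shows "length (eigs (A * B)) = n"
proof -
  note Ac = pos_semidefD(1,2)[OF A]
  obtain R where R: "R \<in> carrier_mat n n" "B = R * transpose_mat R"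
    using pos_semidef_factor[OF B] by metis
  show ?thesis
    unfolding R(2) eigs_mult_congruence[OF Ac(1) R(1)]
    by (rule length_eigs) (use R Ac transpose_congruence[OF Ac R(1)] in auto)
qed

lemma sum_eigs_mult_pos_semidef:
  fixes f f' :: "real \<Rightarrow> real"
  assumes deriv: "\<And>s. 0 < s \<Longrightarrow> (f has_real_derivative f' s) (at s)"
    and mono: "mono_on {0<..} (\<lambda>s. s * f' s)"
    and cont0: "continuous (at_right 0) f"
    and A: "pos_semidef n A" and B: "pos_semidef n B"
  shows "(\<Sum>i<n. f (sqrt (eigs A ! i * eigs B ! (n - 1 - i)))) \<le> (\<Sum>i<n. f (sqrt (eigs (A * B) ! i)))"
    and "(\<Sum>i<n. f (sqrt (eigs (A * B) ! i))) \<le> (\<Sum>i<n. f (sqrt (eigs A ! i * eigs B ! i)))"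
proof -
  let ?A = "\<lambda>t. A + t \<cdot>\<^sub>m 1\<^sub>m n" and ?B = "\<lambda>t. B + t \<cdot>\<^sub>m 1\<^sub>m n"
  note Ac = pos_semidefD(1,2)[OF A] and Bc = pos_semidefD(1,2)[OF B]
  \<comment> \<open>In the limit an argument of \<open>f\<close> may be 0, where only continuity
    from the right is given. Continuity on the closed half-line is enough because all approximating
    arguments lie in it.\<close>
  have "continuous_on {0..} f"
    unfolding continuous_on_eq_continuous_within
  proof
    fix x :: real assume "x \<in> {0..}"
    then consider "x = 0" | "0 < x" by fastforce
    then show "continuous (at x within {0..}) f"
    proof cases
      case 1
      then show ?thesis using cont0 by (simp add: at_within_Ici_at_right)
    next
      case 2
      then show ?thesis
        using DERIV_isCont[OF deriv[OF 2]] continuous_at_imp_continuous_at_within by blast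
    qed
  qed
  note f_lim = continuous_on_tendsto_compose[OF this]
  have pd: "pos_def n (?A t)" "pos_def n (?B t)" if "0 < t" for t
    using pos_def_add_one_smult A B that by auto
  have prod_lim: "((\<lambda>t. f (sqrt (eigs (?A t) ! i * eigs (?B t) ! j))) \<longlongrightarrow> f (sqrt (eigs A ! i * eigs B ! j))) (at_right 0)"
    if ij: "i < n" "j < n" for i j
  proof (rule f_lim)
    show "((\<lambda>t. sqrt (eigs (?A t) ! i * eigs (?B t) ! j)) \<longlongrightarrow> sqrt (eigs A ! i * eigs B ! j)) (at_right 0)"
      unfolding eigs_add_one_smult[OF Ac ij(1)] eigs_add_one_smult[OF Bc ij(2)]
      by (auto intro!: tendsto_eq_intros)
    show "\<forall>\<^sub>F t in at_right 0. sqrt (eigs (?A t) ! i * eigs (?B t) ! j) \<in> {0..}"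
      using eventually_at_right_less[of 0]
      by (rule eventually_mono) (auto intro!: mult_nonneg_nonneg less_imp_le[OF eigs_pos] pd ij)
  qed (use eigs_nonneg[OF A ij(1)] eigs_nonneg[OF B ij(2)] in simp)
  have mult_lim: "((\<lambda>t. f (sqrt (eigs (?A t * ?B t) ! i))) \<longlongrightarrow> f (sqrt (eigs (A * B) ! i))) (at_right 0)"
    if i: "i < n" for i
  proof (rule f_lim)
    show "((\<lambda>t. sqrt (eigs (?A t * ?B t) ! i)) \<longlongrightarrow> sqrt (eigs (A * B) ! i)) (at_right 0)"
      by (intro tendsto_real_sqrt tendsto_eigs_mult_add_one_smult[OF A B i])
    show "\<forall>\<^sub>F t in at_right 0. sqrt (eigs (?A t * ?B t) ! i) \<in> {0..}"
      using eventually_at_right_less[of 0]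
      by (rule eventually_mono) (auto intro!: less_imp_le[OF eigs_mult_pos] pd i)
  qed (use eigs_mult_nonneg[OF A B i] in simp)
  have lims: "((\<lambda>t. \<Sum>i<n. f (sqrt (eigs (?A t * ?B t) ! i))) \<longlongrightarrow> (\<Sum>i<n. f (sqrt (eigs (A * B) ! i)))) (at_right 0)"
    "((\<lambda>t. \<Sum>i<n. f (sqrt (eigs (?A t) ! i * eigs (?B t) ! i))) \<longlongrightarrow> (\<Sum>i<n. f (sqrt (eigs A ! i * eigs B ! i)))) (at_right 0)"
    "((\<lambda>t. \<Sum>i<n. f (sqrt (eigs (?A t) ! i * eigs (?B t) ! (n - 1 - i)))) \<longlongrightarrow> (\<Sum>i<n. f (sqrt (eigs A ! i * eigs B ! (n - 1 - i))))) (at_right 0)"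
    by (intro tendsto_sum mult_lim prod_lim; simp)+
  have ineqs: "\<forall>\<^sub>F t in at_right 0. (\<Sum>i<n. f (sqrt (eigs (?A t) ! i * eigs (?B t) ! (n - 1 - i)))) \<le> (\<Sum>i<n. f (sqrt (eigs (?A t * ?B t) ! i)))"
    "\<forall>\<^sub>F t in at_right 0. (\<Sum>i<n. f (sqrt (eigs (?A t * ?B t) ! i))) \<le> (\<Sum>i<n. f (sqrt (eigs (?A t) ! i * eigs (?B t) ! i)))"
    by (rule eventually_mono[OF eventually_at_right_less], rule sum_eigs_mult_pos_def[OF deriv mono pd], assumption+)+
  show "(\<Sum>i<n. f (sqrt (eigs A ! i * eigs B ! (n - 1 - i)))) \<le> (\<Sum>i<n. f (sqrt (eigs (A * B) ! i)))"
    by (rule tendsto_le[OF trivial_limit_at_right_real lims(1,3) ineqs(1)])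
  show "(\<Sum>i<n. f (sqrt (eigs (A * B) ! i))) \<le> (\<Sum>i<n. f (sqrt (eigs A ! i * eigs B ! i)))"
    by (rule tendsto_le[OF trivial_limit_at_right_real lims(2,1) ineqs(2)])
qed

section \<open>Singular values through Gram matrices\<close>

lemma rev_sorted_sqrt_with_zeros:
  assumes "\<And>x. x \<in># N \<Longrightarrow> 0 \<le> x"
  shows "rev (sorted_list_of_multiset (image_mset sqrt (replicate_mset k 0 + N)))
    = map sqrt (rev (sorted_list_of_multiset N)) @ replicate k 0"
proof -
  let ?xs = "replicate k 0 @ map sqrt (sorted_list_of_multiset N)"
  have "sorted (sorted_list_of_multiset N)"
    by (metis ex_mset sorted_list_of_multiset_mset sorted_sort)
  then have "sorted (map sqrt (sorted_list_of_multiset N))"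
    by (simp add: sorted_wrt_map sorted_wrt_mono_rel[of _ "(\<le>)"])
  then have "sorted ?xs"
    using assms by (auto simp: sorted_append)
  moreover have "mset ?xs = image_mset sqrt (replicate_mset k 0 + N)"
    by simp
  ultimately have "sorted_list_of_multiset (image_mset sqrt (replicate_mset k 0 + N)) = ?xs"
    by (metis sorted_list_of_multiset_mset sorted_sort_id)
  then show ?thesis by (simp add: rev_map)
qed

text \<open>The spectra of P Q and Q P differ by n - m zeros, which come last because the other
  eigenvalues are nonnegative, so the first m entries are unaffected. The factorization is kept
  abstract to cover both Z = X, with P = X^T and Q = X, and Z = X^T Y, with P = Y^T and Q = X X^T
  Y.\<close>

lemma gram_singular_value:
  fixes Z P Q :: "real mat"
  assumes P: "P \<in> carrier_mat n m" and Q: "Q \<in> carrier_mat m n" and "m \<le> n"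
    and gram: "transpose_mat Z * Z = P * Q"
    and len: "length (eigs (Q * P)) = m" and nonneg: "\<And>i. i < m \<Longrightarrow> 0 \<le> eigs (Q * P) ! i"
    and i: "i < m"
  shows "singular_value Z (Suc i) = sqrt (eigs (Q * P) ! i)"
proof -
  have "replicate_mset n (0 :: real) = replicate_mset m 0 + replicate_mset (n - m) 0"
    by (rule multiset_eqI) (use \<open>m \<le> n\<close> in simp)
  then have "replicate_mset m 0 + proots (char_poly (P * Q))
      = replicate_mset m 0 + (replicate_mset (n - m) 0 + proots (char_poly (Q * P)))"
    using proots_char_poly_mult_comm[OF P Q] by (simp add: add.assoc)
  then have eq: "proots (char_poly (P * Q)) = replicate_mset (n - m) 0 + proots (char_poly (Q * P))"
    by simp
  have "0 \<le> x" if "x \<in># proots (char_poly (Q * P))" for x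
  proof -
    have "x \<in> set (eigs (Q * P))" using that by (simp add: eigs_def)
    then show ?thesis using nonneg len by (auto simp: in_set_conv_nth)
  qed
  then have "gram_roots Z = map sqrt (eigs (Q * P)) @ replicate (n - m) 0"
    unfolding gram_roots_def gram eq eigs_def by (rule rev_sorted_sqrt_with_zeros)
  then show ?thesis
    using i len by (simp add: singular_value_def nth_append)
qed

lemma pos_semidef_mult_transpose:
  fixes X :: "real mat"
  assumes X: "X \<in> carrier_mat m n"
  shows "pos_semidef m (X * transpose_mat X)"
  using pos_semidef_congruence[OF pos_def_imp_pos_semidef[OF pos_def_one], of "transpose_mat X" n m] X
  by simp

text \<open>Full rank with m \<le> n provides m linearly independent columns. They form an
  invertible square matrix \<open>M\<close>, and \<open>v\<close>, being orthogonal to every column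
  of \<open>X\<close>, is in the kernel of its transpose.\<close>

lemma full_rank_transpose_mult_vec_zero:
  fixes X :: "real mat"
  assumes X: "X \<in> carrier_mat m n" and "m \<le> n" and full: "full_rank X"
    and v: "v \<in> carrier_vec m" and zero: "transpose_mat X *\<^sub>v v = 0\<^sub>v n"
  shows "v = 0\<^sub>v m"
proof (rule ccontr)
  assume v0: "v \<noteq> 0\<^sub>v m"
  interpret vec_space "TYPE(real)" m .
  have rank: "rank X = m" using full X \<open>m \<le> n\<close> by (simp add: full_rank_def)
  obtain S where S: "maximal S (\<lambda>T. T \<subseteq> set (cols X) \<and> lin_indpt T)"
    using maximal_exists_superset[of "set (cols X)" "\<lambda>T. T \<subseteq> set (cols X) \<and> lin_indpt T" "{}"]
    by (metis (no_types, lifting) List.finite_set empty_subsetI finite_lin_indpt2 finite.emptyI empty_iff)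
  then have "S \<subseteq> set (cols X)" and li: "lin_indpt S" by (auto simp: maximal_def)
  have "card S = m" using rank_card_indpt[OF X S] rank by simp
  obtain xs where xs: "set xs = S" "distinct xs"
    using finite_distinct_list[of S] \<open>S \<subseteq> set (cols X)\<close> finite_subset by blast
  then have len: "length xs = m" using \<open>card S = m\<close> distinct_card by metis
  have sub: "set xs \<subseteq> carrier_vec m" using \<open>S \<subseteq> set (cols X)\<close> cols_dim[of X] X xs by auto
  define M where "M = mat_of_cols m xs"
  have M: "M \<in> carrier_mat m m" unfolding M_def using mat_of_cols_carrier(1)[of m xs] len by simp
  have colsM: "cols M = xs" unfolding M_def using sub by simp
  have "rank M = m" using lin_indpt_full_rank[OF M] xs li colsM by simp
  then have "det M \<noteq> 0" using det_zero_low_rank[OF M] by auto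
  moreover have "transpose_mat M *\<^sub>v v = 0\<^sub>v m"
  proof (rule eq_vecI)
    fix i assume "i < dim_vec (0\<^sub>v m :: real vec)"
    then have i: "i < m" by simp
    then have "col M i \<in> set (cols X)"
      using M colsM xs(1) \<open>S \<subseteq> set (cols X)\<close> len by (metis carrier_matD(2) cols_nth nth_mem subsetD)
    then obtain j where j: "j < n" "col M i = col X j"
      using X by (auto simp: cols_def)
    have "(transpose_mat M *\<^sub>v v) $ i = (transpose_mat X *\<^sub>v v) $ j"
      using i j M X by simp
    then show "(transpose_mat M *\<^sub>v v) $ i = 0\<^sub>v m $ i" using zero i j by simp
  qed (use M in simp)
  then have "det (transpose_mat M) = 0"
    using det_0_iff_vec_prod_zero[of "transpose_mat M" m] M v v0 by auto
  ultimately show False using det_transpose[OF M] by simp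
qed

text \<open>The quadratic form at v is the squared norm of X^T v, which full rank keeps away from 0
  for nonzero v.\<close>

lemma pos_def_mult_transpose:
  fixes X :: "real mat"
  assumes X: "X \<in> carrier_mat m n" and "m \<le> n" and full: "full_rank X"
  shows "pos_def m (X * transpose_mat X)"
  unfolding pos_def_def
proof (intro conjI ballI impI)
  fix v :: "real vec" assume v: "v \<in> carrier_vec m" "v \<noteq> 0\<^sub>v m"
  have "transpose_mat X *\<^sub>v v \<noteq> 0\<^sub>v n"
    using full_rank_transpose_mult_vec_zero[OF X \<open>m \<le> n\<close> full v(1)] v(2) by blast
  moreover have "transpose_mat X *\<^sub>v v \<in> carrier_vec n" using X v by simp
  ultimately show "0 < v \<bullet> ((X * transpose_mat X) *\<^sub>v v)"
    using quadratic_form_congruence[of "1\<^sub>m n" n "transpose_mat X" m v] X v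
      scalar_prod_self_pos[of "transpose_mat X *\<^sub>v v" n] by simp
qed (use pos_semidefD[OF pos_semidef_mult_transpose[OF X]] in auto)

lemma singular_value_eq_eigs:
  assumes X: "X \<in> carrier_mat m n" and "m \<le> n" and i: "i < m"
  shows "singular_value X (Suc i) = sqrt (eigs (X * transpose_mat X) ! i)"
proof -
  note psd = pos_semidef_mult_transpose[OF X]
  show ?thesis
    by (rule gram_singular_value[OF _ X \<open>m \<le> n\<close> refl _ _ i])
      (use X eigs_nonneg[OF psd] length_eigs[OF pos_semidefD(1,2)[OF psd]] in auto)
qed

lemma singular_value_transpose_mult_eq_eigs:
  assumes X: "X \<in> carrier_mat m n" and Y: "Y \<in> carrier_mat m n" and "m \<le> n" and i: "i < m"
  shows "singular_value (transpose_mat X * Y) (Suc i)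
    = sqrt (eigs ((X * transpose_mat X) * (Y * transpose_mat Y)) ! i)"
proof -
  let ?A = "X * transpose_mat X" and ?B = "Y * transpose_mat Y"
  note A = pos_semidef_mult_transpose[OF X] and B = pos_semidef_mult_transpose[OF Y]
  have Ac: "?A \<in> carrier_mat m m" using X by simp
  have comm: "?A * Y * transpose_mat Y = ?A * ?B"
    using Ac Y by (simp add: assoc_mult_mat[of _ m m _ n _ m])
  have "transpose_mat (transpose_mat X * Y) = transpose_mat Y * X"
    using X Y by (simp add: transpose_mult[of _ n m _ n])
  then have "transpose_mat (transpose_mat X * Y) * (transpose_mat X * Y)
      = transpose_mat Y * (X * (transpose_mat X * Y))"
    using X Y by (simp add: assoc_mult_mat[of _ n m _ n _ n])
  also have "X * (transpose_mat X * Y) = ?A * Y"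
    using X Y by (simp add: assoc_mult_mat[of _ m n _ m _ n])
  finally have gram: "transpose_mat (transpose_mat X * Y) * (transpose_mat X * Y) = transpose_mat Y * (?A * Y)" .
  show ?thesis
    unfolding comm[symmetric]
    by (rule gram_singular_value[OF _ _ \<open>m \<le> n\<close> gram _ _ i])
      (use X Y Ac comm length_eigs_mult[OF A B] eigs_mult_nonneg[OF A B] in auto)
qed

text \<open>The restriction m \<le> n is essential: for m = 2, n = 1, X = e_1, Y = e_2 both matrices
  have full rank, yet X^T Y = 0, and the lower bound fails for f(s) = s. As \<open>f\<close> is a
  total function, its being defined at 0 is expressed by \<open>continuous (at_right 0) f\<close>,
  which ties the value \<open>f 0\<close> to the values on the right.\<close>

theorem theorem4:
  fixes f f' :: "real \<Rightarrow> real" and m n :: nat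
  assumes "0 < m" and "0 < n" and "m \<le> n"
    and deriv: "\<And>s. 0 < s \<Longrightarrow> (f has_real_derivative f' s) (at s)"
    and mono: "mono_on {0<..} (\<lambda>s. s * f' s)"
  shows
    "(\<forall>X\<in>carrier_mat m n. \<forall>Y\<in>carrier_mat m n. full_rank X \<longrightarrow> full_rank Y \<longrightarrow>
        (\<Sum>i=1..min m n. f (singular_value X i * singular_value Y (min m n - i + 1)))
          \<le> (\<Sum>i=1..min m n. f (singular_value (transpose_mat X * Y) i)) \<and>
        (\<Sum>i=1..min m n. f (singular_value (transpose_mat X * Y) i))
          \<le> (\<Sum>i=1..min m n. f (singular_value X i * singular_value Y i)))
     \<and>
     (continuous (at_right 0) f \<longrightarrow>
       (\<forall>X\<in>carrier_mat m n. \<forall>Y\<in>carrier_mat m n.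
        (\<Sum>i=1..min m n. f (singular_value X i * singular_value Y (min m n - i + 1)))
          \<le> (\<Sum>i=1..min m n. f (singular_value (transpose_mat X * Y) i)) \<and>
        (\<Sum>i=1..min m n. f (singular_value (transpose_mat X * Y) i))
          \<le> (\<Sum>i=1..min m n. f (singular_value X i * singular_value Y i))))"
proof -
  have min: "min m n = m" using \<open>m \<le> n\<close> by simp
  have shift: "(\<Sum>i=1..m. h i) = (\<Sum>i<m. h (Suc i))" for h :: "nat \<Rightarrow> real"
    by (simp add: sum.atLeast1_atMost_eq)
  \<comment> \<open>With i = Suc j and j < m, the index m - i + 1 is Suc (m - 1 - j); so the
    reversed 1-based index becomes m - 1 - j in the 0-based list.\<close>
  have to_eigs:
    "(\<Sum>i=1..m. f (singular_value X i * singular_value Y (m - i + 1)))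
      = (\<Sum>i<m. f (sqrt (eigs (X * transpose_mat X) ! i * eigs (Y * transpose_mat Y) ! (m - 1 - i))))"
    "(\<Sum>i=1..m. f (singular_value (transpose_mat X * Y) i))
      = (\<Sum>i<m. f (sqrt (eigs ((X * transpose_mat X) * (Y * transpose_mat Y)) ! i)))"
    "(\<Sum>i=1..m. f (singular_value X i * singular_value Y i))
      = (\<Sum>i<m. f (sqrt (eigs (X * transpose_mat X) ! i * eigs (Y * transpose_mat Y) ! i)))"
    if X: "X \<in> carrier_mat m n" and Y: "Y \<in> carrier_mat m n" for X Y
    unfolding shift
    by (auto intro!: sum.cong simp: singular_value_eq_eigs[OF X \<open>m \<le> n\<close>] singular_value_eq_eigs[OF Y \<open>m \<le> n\<close>]
        singular_value_transpose_mult_eq_eigs[OF X Y \<open>m \<le> n\<close>] real_sqrt_mult)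
  show ?thesis
    unfolding min
  proof (rule conjI; intro impI ballI)
    fix X Y :: "real mat" assume X: "X \<in> carrier_mat m n" "full_rank X" and Y: "Y \<in> carrier_mat m n" "full_rank Y"
    note pd = pos_def_mult_transpose[OF X(1) \<open>m \<le> n\<close> X(2)] pos_def_mult_transpose[OF Y(1) \<open>m \<le> n\<close> Y(2)]
    show "(\<Sum>i=1..m. f (singular_value X i * singular_value Y (m - i + 1)))
          \<le> (\<Sum>i=1..m. f (singular_value (transpose_mat X * Y) i)) \<and>
        (\<Sum>i=1..m. f (singular_value (transpose_mat X * Y) i))
          \<le> (\<Sum>i=1..m. f (singular_value X i * singular_value Y i))"
      unfolding to_eigs[OF X(1) Y(1)] using sum_eigs_mult_pos_def[OF deriv mono pd] by (rule conjI)
  next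
    fix X Y :: "real mat" assume cont: "continuous (at_right 0) f"
      and X: "X \<in> carrier_mat m n" and Y: "Y \<in> carrier_mat m n"
    note psd = pos_semidef_mult_transpose[OF X] pos_semidef_mult_transpose[OF Y]
    show "(\<Sum>i=1..m. f (singular_value X i * singular_value Y (m - i + 1)))
          \<le> (\<Sum>i=1..m. f (singular_value (transpose_mat X * Y) i)) \<and>
        (\<Sum>i=1..m. f (singular_value (transpose_mat X * Y) i))
          \<le> (\<Sum>i=1..m. f (singular_value X i * singular_value Y i))"
      unfolding to_eigs[OF X Y] using sum_eigs_mult_pos_semidef[OF deriv mono cont psd] by (rule conjI)
  qed
qed

end
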